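(* Let $G^\star\in\mathcal{O}(d)^n$, let $\Delta\in\mathbb{R}^{nd\times nd}$ be symmetric, and let $C=G^\star G^{\star\top}+\Delta$. Let $\widehat{G}\in\mathcal{O}(d)^n$ be a global maximizer of $\bar f(G)=\operatorname{tr}(G^\top CG)$ over $\mathcal{O}(d)^n$. Suppose that $\|\Delta\|\le\frac{n^{3/4}}{20d^{1/2}}$ and $\|\Delta G^\star\|_\infty\le\frac{n}{20}$. Let $\{G^k\}_{k\ge0}\subset\mathcal{O}(d)^n$ be generated by the (quotient) Riemannian gradient method $$G^{k+1}=\operatorname{Exp}_{G^k}\big(t_k\operatorname{grad}\bar f(G^k)\big),\qquad k\ge 0.$$ Suppose further that, with $\alpha\in(0,1)$ and for some $\underline{t}>0$, for all $k\ge 0$ $$0<\underline{t}\le t_k\le\frac{1-\alpha}{n(d+1)+\|\Delta\|+\sqrt d\,\|\Delta G^k\|_\infty},$$ $$\operatorname{d}_F([G^k],[\widehat{G}])\le\rho_F,\qquad \|G^kQ^k-\widehat{G}\|_\infty\le\rho_\infty,$$ where $Q^k\in\mathcal{O}(d)$ satisfies $\operatorname{d}_F([G^k],[\widehat{G}])=\|G^kQ^k-\widehat{G}\|_F$, $\rho_F=\frac1{10}\min\{\sqrt n,\frac{n}{\|\Delta\|}\}$ and $\rho_\infty=\frac14$. Then the sequence $\{f([G^k])\}_{k\ge0}$ converges Q-linearly to $f([\widehat{G}])$, i.e. $$f([\widehat{G}])-f([G^k])\le\big(f([\widehat{G}])-f([G^0])\big)\lambda^k\quad\text{for each }k\ge0,$$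 and the sequence $\{G^k\}_{k\ge0}$ converges R-linearly to some $G^{*}\in[\widehat{G}]$ (not to be confused with $G^\star$), i.e. $$\operatorname{d}_F([G^k],[\widehat{G}])\le\|G^k-G^{*}\|_F\le a\big(f([\widehat{G}])-f([G^0])\big)^{1/2}\lambda^{k/2}\quad\text{for each }k\ge0,$$ where $a>0$ and $\lambda\in(0,1)$ are constants that depend only on $n$ and $d$.
   Context: Block notation: $X\in\mathbb{R}^{nd\times d}$ is written $X=[X_1;\dots;X_n]$ with $d\times d$ blocks $X_i$ stacked in a column; for an $nd\times nd$ matrix $C$, $C_{i,:}$ is its $i$-th $d\times nd$ block row. $\mathcal{O}(d)^n$ is the set of $X$ with every $X_i$ orthogonal. $\|\cdot\|$ is the operator norm, $\|\cdot\|_F$ the Frobenius norm, and $\|X\|_\infty:=\max_i\|X_i\|_F$ for $X\in\mathbb{R}^{nd\times d}$. For $X,Y\in\mathbb{R}^{nd\times d}$, $[X]=\{XQ:Q\in\mathcal{O}(d)\}$ and $\operatorname{d}_F([X],[Y]):=\min_{Q\in\mathcal{O}(d)}\|X-YQ\|_F$. We write $f([G]):=\bar f(G)=\operatorname{tr}(G^\top CG)$ (well defined on classes). $\mathcal{O}(d)^n$ carries the Riemannian metric induced from $\langle X,Y\rangle=\operatorname{tr}(X^\top Y)$. The Riemannian gradient of $\bar f$ has blocks $(\operatorname{grad}\bar f(G))_i=C_{i,:}G-G_i(C_{i,:}G)^\top G_i$, and for a tangent vector $\xi=[G_1E_1;\dots;G_nE_n]$ with $E_i$ skew-symmetric, $\operatorname{Exp}_G(\xi)=[G_1\exp(E_1);\dots;G_n\exp(E_n)]$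 with $\exp$ the matrix exponential. If $\Delta=0$, $n/\|\Delta\|$ is read as $+\infty$.
   Formalization: The constant λ is allowed to depend on the lower step-size bound t̲ as well as on n and d (a depends only on n and d); a λ depending only on n and d cannot exist, since steps t_k = t̲ → 0 make the first-step decrease arbitrarily small. *)

theory Defs
  imports "HOL-Analysis.Analysis"
begin

text \<open>
  The block index is a finite type \<open>'n\<close> with \<open>n = CARD('n)\<close>, the index inside a block is a
  finite type \<open>'d\<close> with \<open>d = CARD('d)\<close>, and the \<open>nd\<close> scalar rows of a block column are indexed
  by \<open>'n \<times> 'd\<close>. On matrices the library's \<^const>\<open>norm\<close> is the Frobenius norm
  (and \<open>X \<bullet> Y\<close> is the trace inner product), whereas the operator norm is \<open>opnorm\<close> below.
\<close>

type_synonym ('n, 'd) blockcol = "real ^ 'd ^ ('n \<times> 'd)"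
type_synonym ('n, 'd) blockmat = "real ^ ('n \<times> 'd) ^ ('n \<times> 'd)"

definition opnorm :: "real ^ 'k ^ 'm \<Rightarrow> real" where
  "opnorm A = onorm (\<lambda>v. A *v v)"

text \<open>Used both for the \<open>d \<times> d\<close> blocks of a block column and for the \<open>d \<times> nd\<close> block rows
  of a square matrix.\<close>

definition block :: "'a ^ ('n::finite \<times> 'd::finite) \<Rightarrow> 'n \<Rightarrow> 'a ^ 'd" where
  "block X i = (\<chi> a. X $ (i, a))"

definition stack :: "('n::finite \<Rightarrow> 'a ^ 'd::finite) \<Rightarrow> 'a ^ ('n \<times> 'd)" where
  "stack B = (\<chi> p. B (fst p) $ snd p)"

definition block_orthogonal :: "('n::finite, 'd::finite) blockcol set" where
  "block_orthogonal = {X. \<forall>i. orthogonal_matrix (block X i)}"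

definition norm_inf :: "('n::finite, 'd::finite) blockcol \<Rightarrow> real" where
  "norm_inf X = (MAX i. norm (block X i))"

definition orbit :: "('n::finite, 'd::finite) blockcol \<Rightarrow> ('n, 'd) blockcol set" where
  "orbit X = {X ** Q | Q. orthogonal_matrix Q}"

text \<open>The distance between the classes of \<open>X\<close> and \<open>Y\<close>; the infimum is attained, see
  \<open>dF_attained\<close>.\<close>

definition dF :: "('n::finite, 'd::finite) blockcol \<Rightarrow> ('n, 'd) blockcol \<Rightarrow> real" where
  "dF X Y = (INF Q \<in> {Q. orthogonal_matrix Q}. norm (X - Y ** Q))"

definition fbar :: "('n::finite, 'd::finite) blockmat \<Rightarrow> ('n, 'd) blockcol \<Rightarrow> real" where
  "fbar C G = trace (transpose G ** C ** G)"

definition rgrad ::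
    "('n::finite, 'd::finite) blockmat \<Rightarrow> ('n, 'd) blockcol \<Rightarrow> ('n, 'd) blockcol" where
  "rgrad C G = stack (\<lambda>i. block C i ** G
                   - block G i ** transpose (block C i ** G) ** block G i)"

text \<open>Matrices carry the componentwise multiplication of type \<open>vec\<close> in the library, so neither
  \<^const>\<open>exp\<close> nor \<^const>\<open>power\<close> is the matrix version.\<close>

definition mat_pow :: "real ^ 'm ^ 'm \<Rightarrow> nat \<Rightarrow> real ^ 'm ^ 'm" where
  "mat_pow A k = (((**) A) ^^ k) (mat 1)"

definition mat_exp :: "real ^ 'm ^ 'm \<Rightarrow> real ^ 'm ^ 'm" where
  "mat_exp A = (\<Sum>k. (1 / fact k) *\<^sub>R mat_pow A k)"

text \<open>For a tangent vector \<open>\<xi>\<close> with blocks \<open>G\<^sub>i E\<^sub>i\<close>, orthogonality of \<open>G\<^sub>i\<close> gives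
  \<open>E\<^sub>i = G\<^sub>i\<^sup>T \<xi>\<^sub>i\<close>; see \<open>Exp_map_tangent\<close>.\<close>

definition Exp_map ::
    "('n::finite, 'd::finite) blockcol \<Rightarrow> ('n, 'd) blockcol \<Rightarrow> ('n, 'd) blockcol" where
  "Exp_map G \<xi> = stack (\<lambda>i. block G i ** mat_exp (transpose (block G i) ** block \<xi> i))"

text \<open>The quotient \<open>n / \<parallel>\<Delta>\<parallel>\<close> is \<open>+\<infinity>\<close> for \<open>\<Delta> = 0\<close>, while division by zero yields \<open>0\<close> in HOL.\<close>

definition rho_F :: "('n::finite, 'd::finite) blockmat \<Rightarrow> real" where
  "rho_F \<Delta> = (1 / 10) *
     (if \<Delta> = 0 then sqrt (real CARD('n))
      else min (sqrt (real CARD('n))) (real CARD('n) / opnorm \<Delta>))"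

lemma block_stack [simp]: "block (stack B) i = B i"
  by (simp add: block_def stack_def vec_eq_iff)

lemma Exp_map_tangent:
  assumes "G \<in> block_orthogonal"
  shows "Exp_map G (stack (\<lambda>i. block G i ** E i)) = stack (\<lambda>i. block G i ** mat_exp (E i))"
proof -
  have "transpose (block G i) ** (block G i ** E i) = E i" for i
    using assms by (simp add: block_orthogonal_def orthogonal_matrix_def matrix_mul_assoc)
  then show ?thesis by (simp add: Exp_map_def)
qed

lemma norm_matrix_sq:
  fixes A :: "real ^ 'k::finite ^ 'm::finite"
  shows "(norm A)\<^sup>2 = trace (transpose A ** A)"
proof -
  have "(norm A)\<^sup>2 = (\<Sum>i\<in>UNIV. \<Sum>j\<in>UNIV. A $ i $ j * A $ i $ j)"
    by (simp add: power2_norm_eq_inner inner_vec_def)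
  also have "\<dots> = trace (transpose A ** A)"
    unfolding trace_def matrix_matrix_mult_def transpose_def
    by (simp add: sum.swap[of _ "UNIV :: 'm set"])
  finally show ?thesis .
qed

lemma continuous_on_matrix_mult [continuous_intros]:
  fixes f :: "'x::topological_space \<Rightarrow> real ^ 'k::finite ^ 'm" and g :: "'x \<Rightarrow> real ^ 'l ^ 'k"
  assumes "continuous_on S f" "continuous_on S g"
  shows "continuous_on S (\<lambda>x. f x ** g x)"
  unfolding matrix_matrix_mult_def
  by (intro continuous_intros assms)

lemma compact_orthogonal_matrices:
  "compact {Q :: real ^ 'd::finite ^ 'd. orthogonal_matrix Q}"
proof -
  have "norm Q = sqrt (real CARD('d))" if "orthogonal_matrix Q" for Q :: "real ^ 'd ^ 'd"
  proof -
    have "(norm Q)\<^sup>2 = real CARD('d)"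
      using that by (simp add: norm_matrix_sq orthogonal_matrix_def trace_def mat_def)
    then show ?thesis by (metis norm_ge_zero real_sqrt_unique)
  qed
  then have "bounded {Q :: real ^ 'd ^ 'd. orthogonal_matrix Q}"
    by (auto simp: bounded_iff intro: exI[of _ "sqrt (real CARD('d))"])
  moreover have "closed {Q :: real ^ 'd ^ 'd. transpose Q ** Q = mat 1}"
    by (intro closed_Collect_eq continuous_intros) (simp add: transpose_def, intro continuous_intros)
  then have "closed {Q :: real ^ 'd ^ 'd. orthogonal_matrix Q}"
    by (simp add: orthogonal_matrix)
  ultimately show ?thesis by (simp add: compact_eq_bounded_closed)
qed

lemma dF_attained:
  fixes X Y :: "('n::finite, 'b::finite) blockcol"
  obtains Q where "orthogonal_matrix Q" "dF X Y = norm (X - Y ** Q)"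
    "\<And>R. orthogonal_matrix R \<Longrightarrow> norm (X - Y ** Q) \<le> norm (X - Y ** R)"
proof -
  have "{Q :: real ^ 'b ^ 'b. orthogonal_matrix Q} \<noteq> {}"
    using orthogonal_matrix_id by blast
  moreover have "continuous_on {Q. orthogonal_matrix Q} (\<lambda>Q. norm (X - Y ** Q))"
    by (intro continuous_intros)
  ultimately obtain Q where Q: "orthogonal_matrix Q"
      "\<And>R. orthogonal_matrix R \<Longrightarrow> norm (X - Y ** Q) \<le> norm (X - Y ** R)"
    using continuous_attains_inf[OF compact_orthogonal_matrices] by blast
  have "dF X Y = norm (X - Y ** Q)"
    unfolding dF_def using Q by (intro cInf_eq_minimum) auto
  with Q that show thesis by blast
qed

end

theory Submission
  imports Defs
begin

text \<open>
  Let \<open>G\<close> be an iterate, rotated so that its distance \<open>D = G - Ghat\<close> to the maximizer is minimal.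
  At the maximizer every \<open>S\<^sub>i = Ghat\<^sub>i\<^sup>T (C Ghat)\<^sub>i\<close> is symmetric, and comparing with reflected
  blocks gives \<open>S\<^sub>i \<ge> - \<parallel>\<Delta>\<parallel>\<close>. The noise bounds put \<open>(C Ghat)\<^sub>i\<close> within \<open>0.08 n\<close> of an orthogonal
  matrix times \<open>n\<close>, so that \<open>S\<^sub>i \<ge> 0.6 n\<close>. Writing \<open>R\<^sub>i = Ghat\<^sub>i\<^sup>T G\<^sub>i\<close>, the gradient at \<open>G\<close> has, up to the factors \<open>G\<^sub>i\<close>,
  blocks \<open>R\<^sub>i\<^sup>T S\<^sub>i - S\<^sub>i R\<^sub>i\<close>, of norm at least \<open>1.05 n \<parallel>D\<^sub>i\<parallel>\<close>, up to an error of norm at most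
  \<open>2 \<parallel>C D\<parallel> \<le> 0.6 n \<parallel>D\<parallel>\<close>. Together with a quadratic upper bound on the gap of the objective this
  is a gradient domination inequality, and with sufficient ascent along the exponential map it
  yields linear convergence of the values and, by telescoping the square roots of the gaps,
  of the iterates.
\<close>

section \<open>Matrices and block columns\<close>

lemma inner_matrix_eq_sum:
  fixes A B :: "real ^ 'k::finite ^ 'm::finite"
  shows "A \<bullet> B = (\<Sum>i\<in>UNIV. \<Sum>j\<in>UNIV. A $ i $ j * B $ i $ j)"
  by (simp add: inner_vec_def)

lemma inner_transpose:
  fixes A B :: "real ^ 'k::finite ^ 'm::finite"
  shows "transpose A \<bullet> transpose B = A \<bullet> B"
  unfolding inner_matrix_eq_sum transpose_def by (simp add: sum.swap[of _ "UNIV :: 'k set"])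

lemma norm_transpose [simp]:
  fixes A :: "real ^ 'k::finite ^ 'm::finite"
  shows "norm (transpose A) = norm A"
  by (simp add: norm_eq_sqrt_inner inner_transpose)

lemma inner_mult_left:
  fixes A :: "real ^ 'k::finite ^ 'm::finite" and B :: "real ^ 'l::finite ^ 'm" and X :: "real ^ 'k ^ 'l"
  shows "A \<bullet> (B ** X) = (transpose B ** A) \<bullet> X"
proof -
  have "A \<bullet> (B ** X) = (\<Sum>i\<in>UNIV. \<Sum>j\<in>UNIV. \<Sum>l\<in>UNIV. A $ i $ j * B $ i $ l * X $ l $ j)"
    unfolding inner_matrix_eq_sum matrix_matrix_mult_def by (simp add: sum_distrib_left mult.assoc)
  also have "\<dots> = (\<Sum>i\<in>UNIV. \<Sum>l\<in>UNIV. \<Sum>j\<in>UNIV. A $ i $ j * B $ i $ l * X $ l $ j)"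
    by (intro sum.cong refl sum.swap)
  also have "\<dots> = (\<Sum>l\<in>UNIV. \<Sum>i\<in>UNIV. \<Sum>j\<in>UNIV. A $ i $ j * B $ i $ l * X $ l $ j)"
    by (rule sum.swap)
  also have "\<dots> = (\<Sum>l\<in>UNIV. \<Sum>j\<in>UNIV. \<Sum>i\<in>UNIV. A $ i $ j * B $ i $ l * X $ l $ j)"
    by (intro sum.cong refl sum.swap)
  also have "\<dots> = (transpose B ** A) \<bullet> X"
    unfolding inner_matrix_eq_sum matrix_matrix_mult_def transpose_def
    by (simp add: sum_distrib_left sum_distrib_right mult_ac)
  finally show ?thesis .
qed

lemma inner_mult_right:
  fixes A :: "real ^ 'k::finite ^ 'm::finite" and B :: "real ^ 'k ^ 'l::finite" and X :: "real ^ 'l ^ 'm"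
  shows "A \<bullet> (X ** B) = (A ** transpose B) \<bullet> X"
proof -
  have "A \<bullet> (X ** B) = transpose A \<bullet> (transpose B ** transpose X)"
    by (metis inner_transpose matrix_transpose_mul)
  also have "\<dots> = (A ** transpose B) \<bullet> X"
    by (metis inner_mult_left inner_transpose matrix_transpose_mul)
  finally show ?thesis .
qed

lemma inner_eq_trace:
  fixes A B :: "real ^ 'k::finite ^ 'm::finite"
  shows "A \<bullet> B = trace (transpose A ** B)"
  unfolding inner_matrix_eq_sum trace_def matrix_matrix_mult_def transpose_def
  by (simp add: sum.swap[of _ "UNIV :: 'm set"])

section \<open>Product bounds from rows and columns\<close>

lemma norm_sq_columns:
  fixes B :: "real ^ 'l::finite ^ 'k::finite"
  shows "(norm B)\<^sup>2 = (\<Sum>j\<in>UNIV. (norm (column j B))\<^sup>2)"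
  unfolding power2_norm_eq_inner inner_matrix_eq_sum
  by (subst sum.swap) (simp add: inner_vec_def column_def)

lemma norm_sq_rows:
  fixes B :: "real ^ 'l::finite ^ 'k::finite"
  shows "(norm B)\<^sup>2 = (\<Sum>j\<in>UNIV. (norm (row j B))\<^sup>2)"
  unfolding power2_norm_eq_inner inner_matrix_eq_sum
  by (simp add: inner_vec_def row_def)

lemma column_matrix_mult:
  fixes A :: "real ^ 'k::finite ^ 'm::finite" and B :: "real ^ 'l::finite ^ 'k"
  shows "column j (A ** B) = A *v column j B"
  by (simp add: vec_eq_iff column_def matrix_matrix_mult_def matrix_vector_mult_def)

text \<open>The squared Frobenius norm of a product adds up over the columns of \<open>B\<close>, so
  a bound of \<open>A\<close> on vectors passes to matrices. The factor \<open>c\<close> will be the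
  Frobenius norm, \<open>opnorm\<close>, or the bound on \<open>S i\<close>.\<close>

lemma norm_matrix_mult_le_by:
  fixes A :: "real ^ 'k::finite ^ 'm::finite" and B :: "real ^ 'l::finite ^ 'k"
  assumes "\<And>v. norm (A *v v) \<le> c * norm v" and "0 \<le> c"
  shows "norm (A ** B) \<le> c * norm B"
proof (rule power2_le_imp_le)
  have "(norm (A ** B))\<^sup>2 = (\<Sum>j\<in>UNIV. (norm (A *v column j B))\<^sup>2)"
    by (simp add: norm_sq_columns column_matrix_mult)
  also have "\<dots> \<le> (\<Sum>j\<in>UNIV. (c * norm (column j B))\<^sup>2)"
    by (intro sum_mono power_mono assms norm_ge_zero)
  also have "\<dots> = (c * norm B)\<^sup>2"
    by (simp add: norm_sq_columns[of B] power_mult_distrib sum_distrib_left)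
  finally show "(norm (A ** B))\<^sup>2 \<le> (c * norm B)\<^sup>2" .
qed (use assms in simp)

lemma norm_matrix_vector_le:
  fixes A :: "real ^ 'k::finite ^ 'm::finite"
  shows "norm (A *v v) \<le> norm A * norm v"
proof (rule power2_le_imp_le)
  have "(norm (A *v v))\<^sup>2 = (\<Sum>i\<in>UNIV. (row i A \<bullet> v)\<^sup>2)"
    unfolding power2_norm_eq_inner
    by (simp add: inner_vec_def matrix_vector_mult_def row_def power2_eq_square)
  also have "\<dots> \<le> (\<Sum>i\<in>UNIV. (norm (row i A))\<^sup>2 * (norm v)\<^sup>2)"
    by (intro sum_mono) (simp add: Cauchy_Schwarz_ineq power2_norm_eq_inner)
  also have "\<dots> = (norm A * norm v)\<^sup>2"
    by (simp add: norm_sq_rows[of A] power_mult_distrib sum_distrib_right)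
  finally show "(norm (A *v v))\<^sup>2 \<le> (norm A * norm v)\<^sup>2" .
qed simp

lemma norm_matrix_mult_le:
  fixes A :: "real ^ 'k::finite ^ 'm::finite" and B :: "real ^ 'l::finite ^ 'k"
  shows "norm (A ** B) \<le> norm A * norm B"
  by (intro norm_matrix_mult_le_by norm_matrix_vector_le norm_ge_zero)

lemma norm_matrix_vector_opnorm_le:
  fixes A :: "real ^ 'k::finite ^ 'm::finite"
  shows "norm (A *v v) \<le> opnorm A * norm v"
  unfolding opnorm_def by (rule onorm) (rule matrix_vector_mul_bounded_linear)

lemma opnorm_nonneg: "0 \<le> opnorm A"
  for A :: "real ^ 'k::finite ^ 'm::finite"
  unfolding opnorm_def by (rule onorm_pos_le) (rule matrix_vector_mul_bounded_linear)

lemma norm_matrix_mult_opnorm_le: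
  fixes A :: "real ^ 'k::finite ^ 'm::finite" and B :: "real ^ 'l::finite ^ 'k"
  shows "norm (A ** B) \<le> opnorm A * norm B"
  by (intro norm_matrix_mult_le_by norm_matrix_vector_opnorm_le opnorm_nonneg)

text \<open>Supplies the distributivity rules in \<open>matrix_mult_simps\<close> and the product
  rule for matrix-valued curves.\<close>

lemma bounded_bilinear_matrix_mult:
  "bounded_bilinear ((**) :: real ^ 'k::finite ^ 'm::finite \<Rightarrow> real ^ 'l::finite ^ 'k \<Rightarrow> real ^ 'l ^ 'm)"
proof
  fix A A' :: "real ^ 'k ^ 'm" and B B' :: "real ^ 'l ^ 'k" and r :: real
  show "(A + A') ** B = A ** B + A' ** B"
    by (simp add: vec_eq_iff matrix_matrix_mult_def sum.distrib distrib_right)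
  show "A ** (B + B') = A ** B + A ** B'"
    by (rule matrix_add_ldistrib)
  show "(r *\<^sub>R A) ** B = r *\<^sub>R (A ** B)"
    by (simp add: vec_eq_iff matrix_matrix_mult_def sum_distrib_left mult.assoc)
  show "A ** (r *\<^sub>R B) = r *\<^sub>R (A ** B)"
    by (simp add: vec_eq_iff matrix_matrix_mult_def sum_distrib_left mult_ac)
  show "\<exists>K. \<forall>(A :: real ^ 'k ^ 'm) (B :: real ^ 'l ^ 'k). norm (A ** B) \<le> norm A * norm B * K"
    by (rule exI[of _ 1]) (simp add: norm_matrix_mult_le)
qed

lemmas matrix_mult_simps =
  bounded_bilinear.add_left[OF bounded_bilinear_matrix_mult]
  bounded_bilinear.add_right[OF bounded_bilinear_matrix_mult]
  bounded_bilinear.diff_left[OF bounded_bilinear_matrix_mult]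
  bounded_bilinear.diff_right[OF bounded_bilinear_matrix_mult]
  bounded_bilinear.minus_left[OF bounded_bilinear_matrix_mult]
  bounded_bilinear.minus_right[OF bounded_bilinear_matrix_mult]
  bounded_bilinear.scaleR_left[OF bounded_bilinear_matrix_mult]
  bounded_bilinear.scaleR_right[OF bounded_bilinear_matrix_mult]

lemma bounded_linear_transpose:
  "bounded_linear (transpose :: real ^ 'k::finite ^ 'm::finite \<Rightarrow> real ^ 'm ^ 'k)"
proof (rule bounded_linear_intro[where K = 1])
  show "norm (transpose A) \<le> norm A * 1" for A :: "real ^ 'k ^ 'm"
    by simp
qed (simp_all add: transpose_def vec_eq_iff)

lemmas transpose_linear_simps =
  linear_add[OF bounded_linear.linear[OF bounded_linear_transpose]]
  linear_diff[OF bounded_linear.linear[OF bounded_linear_transpose]]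
  linear_neg[OF bounded_linear.linear[OF bounded_linear_transpose]]
  linear_scale[OF bounded_linear.linear[OF bounded_linear_transpose]]

section \<open>Invariance of norms under orthogonal factors\<close>

lemma norm_orthogonal_mult_left:
  fixes Q :: "real ^ 'k::finite ^ 'k" and X :: "real ^ 'l::finite ^ 'k"
  assumes "orthogonal_matrix Q"
  shows "norm (Q ** X) = norm X"
  using assms
  by (simp add: norm_eq_sqrt_inner inner_mult_left matrix_mul_assoc orthogonal_matrix_def)

lemma norm_orthogonal_mult_right:
  fixes Q :: "real ^ 'k::finite ^ 'k" and X :: "real ^ 'k ^ 'l::finite"
  assumes "orthogonal_matrix Q"
  shows "norm (X ** Q) = norm X"
  using assms
  by (simp add: norm_eq_sqrt_inner inner_mult_right orthogonal_matrix_def flip: matrix_mul_assoc)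

lemma norm_orthogonal_matrix_vector:
  fixes Q :: "real ^ 'k::finite ^ 'k"
  assumes "orthogonal_matrix Q"
  shows "norm (Q *v x) = norm x"
proof -
  have "(Q *v x) \<bullet> (Q *v x) = x \<bullet> ((transpose Q ** Q) *v x)"
    by (metis dot_lmul_matrix inner_commute matrix_vector_mul_assoc transpose_matrix_vector)
  then show ?thesis
    using assms by (simp add: norm_eq_sqrt_inner orthogonal_matrix_def)
qed

section \<open>Decomposition into blocks\<close>

lemma norm_sq_blocks:
  fixes X :: "real ^ 'k::finite ^ ('n::finite \<times> 'd::finite)"
  shows "(norm X)\<^sup>2 = (\<Sum>i\<in>UNIV. (norm (block X i))\<^sup>2)"
  unfolding power2_norm_eq_inner inner_vec_def block_def
  by (simp add: UNIV_Times_UNIV[symmetric] sum.cartesian_product' del: UNIV_Times_UNIV)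

lemma inner_blocks:
  fixes X :: "real ^ 'k::finite ^ ('n::finite \<times> 'd::finite)"
  shows "X \<bullet> Y = (\<Sum>i\<in>UNIV. block X i \<bullet> block Y i)"
  unfolding inner_vec_def block_def
  by (simp add: UNIV_Times_UNIV[symmetric] sum.cartesian_product' del: UNIV_Times_UNIV)

lemma norm_block_le: "norm (block X i) \<le> norm X"
  for X :: "real ^ 'k::finite ^ ('n::finite \<times> 'd::finite)"
  by (rule power2_le_imp_le) (auto simp: norm_sq_blocks intro: member_le_sum[of i UNIV "\<lambda>i. (norm (block X i))\<^sup>2"])

lemma norm_le_by_blocks:
  fixes X :: "real ^ 'k::finite ^ ('n::finite \<times> 'd::finite)"
    and Y :: "real ^ 'l::finite ^ ('n \<times> 'e::finite)"
  assumes "\<And>i. norm (block X i) \<le> c * norm (block Y i)" "0 \<le> c"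
  shows "norm X \<le> c * norm Y"
proof (rule power2_le_imp_le)
  have "(norm X)\<^sup>2 \<le> (\<Sum>i\<in>UNIV. (c * norm (block Y i))\<^sup>2)"
    unfolding norm_sq_blocks by (intro sum_mono power_mono assms norm_ge_zero)
  also have "\<dots> = (c * norm Y)\<^sup>2"
    by (simp add: norm_sq_blocks[of Y] power_mult_distrib sum_distrib_left)
  finally show "(norm X)\<^sup>2 \<le> (c * norm Y)\<^sup>2" .
qed (use assms in simp)

lemma block_mult [simp]: "block (A ** B) i = block A i ** B"
  by (simp add: block_def matrix_matrix_mult_def vec_eq_iff)

lemma block_linear [simp]:
  fixes X Y :: "real ^ 'k::finite ^ ('n::finite \<times> 'd::finite)"
  shows "block (X + Y) i = block X i + block Y i" "block (X - Y) i = block X i - block Y i"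
    "block (- X) i = - block X i" "block (c *\<^sub>R X) i = c *\<^sub>R block X i"
  by (simp_all add: block_def vec_eq_iff)

lemma block_eq_iff: "X = Y \<longleftrightarrow> (\<forall>i. block X i = block Y i)"
  by (auto simp: block_def vec_eq_iff)

lemma transpose_mult_blocks:
  fixes X :: "real ^ 'k::finite ^ ('n::finite \<times> 'd::finite)" and Y :: "real ^ 'l::finite ^ ('n \<times> 'd)"
  shows "transpose X ** Y = (\<Sum>i\<in>UNIV. transpose (block X i) ** block Y i)"
  unfolding matrix_matrix_mult_def transpose_def block_def
  by (simp add: vec_eq_iff UNIV_Times_UNIV[symmetric] sum.cartesian_product' del: UNIV_Times_UNIV)

lemma norm_block_le_norm_inf: "norm (block X i) \<le> norm_inf X"
  unfolding norm_inf_def by (rule Max_ge) auto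

lemma norm_inf_le: "norm_inf X \<le> c \<longleftrightarrow> (\<forall>i. norm (block X i) \<le> c)"
  unfolding norm_inf_def by (subst Max_le_iff) auto

lemma norm_inf_nonneg: "0 \<le> norm_inf X"
  by (meson norm_block_le_norm_inf norm_ge_zero order_trans)

section \<open>The matrix exponential\<close>

lemma mat_pow_0 [simp]: "mat_pow A 0 = mat 1"
  by (simp add: mat_pow_def)

lemma mat_pow_Suc [simp]: "mat_pow A (Suc k) = A ** mat_pow A k"
  by (simp add: mat_pow_def)

lemma mat_pow_commute: "mat_pow A k ** A = A ** mat_pow A k"
  by (induction k) (simp_all flip: matrix_mul_assoc)

lemma mat_pow_scaleR: "mat_pow (s *\<^sub>R A) k = s ^ k *\<^sub>R mat_pow A k"
  by (induction k) (simp_all add: matrix_mult_simps mult.commute)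

text \<open>The factor \<open>norm (mat 1)\<close> covers \<open>k = 0\<close>: the Frobenius norm
  of the identity is the square root of the dimension, not 1.\<close>

lemma norm_mat_pow_le: "norm (mat_pow A k) \<le> norm (mat 1 :: real ^ 'm::finite ^ 'm) * norm A ^ k"
  for A :: "real ^ 'm ^ 'm"
proof (induction k)
  case (Suc k)
  have "norm (mat_pow A (Suc k)) \<le> norm A * norm (mat_pow A k)"
    by (simp add: norm_matrix_mult_le)
  also have "\<dots> \<le> norm A * (norm (mat 1 :: real ^ 'm ^ 'm) * norm A ^ k)"
    by (intro mult_left_mono Suc norm_ge_zero)
  finally show ?case by (simp add: mult_ac)
qed simp

lemma summable_mat_exp: "summable (\<lambda>k. (1 / fact k) *\<^sub>R mat_pow A k)"
  for A :: "real ^ 'm::finite ^ 'm"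
proof (rule summable_comparison_test')
  show "summable (\<lambda>k. norm (mat 1 :: real ^ 'm ^ 'm) * (inverse (fact k) * norm A ^ k))"
    by (intro summable_mult summable_exp)
  show "norm ((1 / fact k) *\<^sub>R mat_pow A k) \<le> norm (mat 1 :: real ^ 'm ^ 'm) * (inverse (fact k) * norm A ^ k)"
    for k :: nat
    using mult_left_mono[OF norm_mat_pow_le[of A k], of "inverse (fact k)"] 
    by (simp add: divide_inverse mult_ac)
qed

lemma mat_exp_0 [simp]: "mat_exp (0 :: real ^ 'm::finite ^ 'm) = mat 1"
proof -
  have "(\<lambda>k. (1 / fact k) *\<^sub>R mat_pow (0 :: real ^ 'm ^ 'm) k) = (\<lambda>k. if k = 0 then mat 1 else 0)"
  proof
    show "(1 / fact k) *\<^sub>R mat_pow (0 :: real ^ 'm ^ 'm) k = (if k = 0 then mat 1 else 0)" for k :: nat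
      by (cases k) (simp_all add: bounded_bilinear.zero_left[OF bounded_bilinear_matrix_mult])
  qed
  then show ?thesis
    unfolding mat_exp_def using suminf_finite[of "{0}" "\<lambda>k. if k = 0 then mat 1 else 0 :: real ^ 'm ^ 'm"] by simp
qed

section \<open>Derivatives of the exponential along a line\<close>

lemma inner_mat_exp: "V \<bullet> mat_exp A = (\<Sum>k. V \<bullet> ((1 / fact k) *\<^sub>R mat_pow A k))"
  for A :: "real ^ 'm::finite ^ 'm"
  unfolding mat_exp_def
  by (rule bounded_linear.suminf[OF bounded_linear_inner_right summable_mat_exp])

text \<open>Paired with a fixed \<open>V\<close>, the exponential along a line is a scalar power
  series in \<open>s\<close>, which may be differentiated term by term; shifting the coefficients
  moves one factor \<open>A\<close> over to \<open>V\<close>.\<close>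

lemma DERIV_inner_mat_exp:
  fixes A V :: "real ^ 'm::finite ^ 'm"
  shows "((\<lambda>s. V \<bullet> mat_exp (s *\<^sub>R A)) has_real_derivative V \<bullet> (A ** mat_exp (s *\<^sub>R A))) (at s)"
proof -
  define c where "c k = V \<bullet> ((1 / fact k) *\<^sub>R mat_pow A k)" for k
  have term_eq: "c k * s ^ k = V \<bullet> ((1 / fact k) *\<^sub>R mat_pow (s *\<^sub>R A) k)" for k and s :: real
    by (simp add: c_def mat_pow_scaleR)
  have sm: "summable (\<lambda>k. c k * s ^ k)" for s :: real
    unfolding term_eq by (intro bounded_linear.summable[OF bounded_linear_inner_right] summable_mat_exp)
  have "((\<lambda>s. \<Sum>k. c k * s ^ k) has_real_derivative (\<Sum>k. diffs c k * s ^ k)) (at s)"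
    using sm by (rule termdiffs_strong_converges_everywhere)
  moreover have "diffs c k * s ^ k = (transpose A ** V) \<bullet> ((1 / fact k) *\<^sub>R mat_pow (s *\<^sub>R A) k)" for k
    by (simp add: diffs_def c_def mat_pow_scaleR inner_mult_left divide_simps)
  ultimately have "((\<lambda>s. V \<bullet> mat_exp (s *\<^sub>R A)) has_real_derivative
      (transpose A ** V) \<bullet> mat_exp (s *\<^sub>R A)) (at s)"
    by (simp only: term_eq inner_mat_exp)
  then show ?thesis
    by (simp only: inner_mult_left)
qed

lemma has_vector_derivative_mat_exp:
  fixes A :: "real ^ 'm::finite ^ 'm"
  shows "((\<lambda>s. mat_exp (s *\<^sub>R A)) has_vector_derivative A ** mat_exp (s *\<^sub>R A)) (at s)"
  unfolding has_vector_derivative_def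
proof (subst has_derivative_componentwise_within, rule ballI)
  fix b :: "real ^ 'm ^ 'm"
  show "((\<lambda>x. mat_exp (x *\<^sub>R A) \<bullet> b) has_derivative (\<lambda>x. x *\<^sub>R (A ** mat_exp (s *\<^sub>R A)) \<bullet> b)) (at s)"
    using DERIV_inner_mat_exp[of b A s, THEN has_field_derivative_imp_has_derivative]
    by (simp add: inner_commute[of _ b] mult.commute[of _ "b \<bullet> _"])
qed

text \<open>Skewness makes the two terms in the derivative of
  \<open>transpose (\<phi> s) ** \<phi> s\<close> cancel, so this product keeps its value
  \<open>mat 1\<close> from \<open>s = 0\<close>.\<close>

lemma orthogonal_mat_exp:
  fixes E :: "real ^ 'm::finite ^ 'm"
  assumes skew: "transpose E = - E"
  shows "orthogonal_matrix (mat_exp E)"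
proof -
  define \<phi> where "\<phi> s = mat_exp (s *\<^sub>R E)" for s :: real
  have d: "(\<phi> has_vector_derivative E ** \<phi> s) (at s)" for s
    unfolding \<phi>_def by (rule has_vector_derivative_mat_exp)
  have dt: "((\<lambda>s. transpose (\<phi> s)) has_vector_derivative transpose (E ** \<phi> s)) (at s)" for s
    by (rule bounded_linear.has_vector_derivative[OF bounded_linear_transpose d])
  have "((\<lambda>s. transpose (\<phi> s) ** \<phi> s) has_vector_derivative
      transpose (\<phi> s) ** (E ** \<phi> s) + transpose (E ** \<phi> s) ** \<phi> s) (at s)" for s
    by (rule bounded_bilinear.has_vector_derivative[OF bounded_bilinear_matrix_mult dt d])
  then have "((\<lambda>s. transpose (\<phi> s) ** \<phi> s) has_vector_derivative 0) (at s)" for s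
    by (simp add: matrix_transpose_mul skew matrix_mult_simps flip: matrix_mul_assoc)
  then have "\<exists>c. \<forall>s\<in>UNIV. transpose (\<phi> s) ** \<phi> s = c"
    by (intro has_derivative_zero_constant convex_UNIV) (simp add: has_vector_derivative_def)
  then have "transpose (\<phi> 1) ** \<phi> 1 = transpose (\<phi> 0) ** \<phi> 0"
    by auto
  then show ?thesis
    by (simp add: \<phi>_def orthogonal_matrix)
qed

lemma mat_exp_scaleR_skew_orthogonal:
  fixes E :: "real ^ 'm::finite ^ 'm"
  assumes "transpose E = - E"
  shows "orthogonal_matrix (mat_exp (s *\<^sub>R E))"
  using assms by (intro orthogonal_mat_exp) (simp add: transpose_scalar)

text \<open>Lagrange's remainder is a scalar statement, hence the pairing with \<open>V\<close>, on
  which the point \<open>s\<close> depends. For skew \<open>E\<close> the factor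
  \<open>mat_exp (s *\<^sub>R E)\<close> is orthogonal wherever \<open>s\<close> lies, so the
  remainder can be bounded without locating \<open>s\<close>.\<close>

lemma mat_exp_Taylor:
  fixes E V :: "real ^ 'm::finite ^ 'm"
  obtains s where "V \<bullet> mat_exp E =
    (\<Sum>m<n. V \<bullet> mat_pow E m / fact m) + V \<bullet> (mat_pow E n ** mat_exp (s *\<^sub>R E)) / fact n"
proof -
  define diff where "diff m s = V \<bullet> (mat_pow E m ** mat_exp (s *\<^sub>R E))" for m :: nat and s :: real
  have "DERIV (diff m) s :> diff (Suc m) s" for m s
  proof -
    have "diff m = (\<lambda>s. (transpose (mat_pow E m) ** V) \<bullet> mat_exp (s *\<^sub>R E))"
      by (simp add: diff_def inner_mult_left fun_eq_iff)
    moreover have "diff (Suc m) s = (transpose (mat_pow E m) ** V) \<bullet> (E ** mat_exp (s *\<^sub>R E))"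
      unfolding diff_def inner_mult_left[symmetric] mat_pow_Suc mat_pow_commute[symmetric]
      by (simp only: matrix_mul_assoc)
    ultimately show ?thesis
      using DERIV_inner_mat_exp[of "transpose (mat_pow E m) ** V" E s] by simp
  qed
  then have "\<exists>s. diff 0 1 = (\<Sum>m<n. diff m 0 / fact m * 1 ^ m) + diff n s / fact n * 1 ^ n"
    using Maclaurin_all_le[of diff "diff 0" 1 n] by blast
  then show thesis
    using that by (auto simp: diff_def)
qed

text \<open>The first-order Taylor formula is tested against the difference itself, and one factor
  of its norm cancels.\<close>

lemma norm_mat_exp_diff_le:
  fixes E :: "real ^ 'm::finite ^ 'm"
  assumes skew: "transpose E = - E"
  shows "norm (mat_exp E - mat 1) \<le> norm E"
proof -
  define V where "V = mat_exp E - mat 1"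
  obtain s where s: "V \<bullet> mat_exp E = V \<bullet> mat 1 + V \<bullet> (E ** mat_exp (s *\<^sub>R E))"
    by (rule mat_exp_Taylor[of V E 1]) simp
  have "norm V * norm V = V \<bullet> V"
    by (simp add: power2_norm_eq_inner flip: power2_eq_square)
  also have "\<dots> = V \<bullet> (E ** mat_exp (s *\<^sub>R E))"
    using s by (simp add: V_def inner_diff_right)
  also have "\<dots> \<le> norm V * norm (E ** mat_exp (s *\<^sub>R E))"
    by (rule norm_cauchy_schwarz)
  also have "\<dots> = norm V * norm E"
    by (simp add: norm_orthogonal_mult_right mat_exp_scaleR_skew_orthogonal skew)
  finally show ?thesis
    unfolding V_def[symmetric] by (cases "norm V = 0") (auto simp: mult_le_cancel_left)
qed

lemma inner_mat_exp_remainder_le: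
  fixes E V :: "real ^ 'm::finite ^ 'm"
  assumes skew: "transpose E = - E"
  shows "\<bar>V \<bullet> (mat_exp E - mat 1 - E)\<bar> \<le> norm V * (norm E)\<^sup>2 / 2"
proof -
  obtain s where s: "V \<bullet> mat_exp E = V \<bullet> mat 1 + V \<bullet> E + V \<bullet> ((E ** E) ** mat_exp (s *\<^sub>R E)) / 2"
    by (rule mat_exp_Taylor[of V E 2]) (simp add: numeral_2_eq_2 matrix_mul_assoc)
  have "\<bar>V \<bullet> ((E ** E) ** mat_exp (s *\<^sub>R E))\<bar> \<le> norm V * norm ((E ** E) ** mat_exp (s *\<^sub>R E))"
    by (rule Cauchy_Schwarz_ineq2)
  also have "\<dots> = norm V * norm (E ** E)"
    by (simp add: norm_orthogonal_mult_right mat_exp_scaleR_skew_orthogonal skew)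
  also have "\<dots> \<le> norm V * (norm E)\<^sup>2"
    by (simp add: norm_matrix_mult_le power2_eq_square mult_left_mono)
  finally show ?thesis
    using s by (simp add: inner_diff_right)
qed

section \<open>Ascent along the exponential map\<close>

text \<open>\<open>A - transpose A\<close> is twice the skew part of \<open>A\<close> and orthogonal
  to the symmetric part. This is the first-order gain of a move along the gradient.\<close>

lemma inner_self_diff_transpose:
  fixes A :: "real ^ 'm::finite ^ 'm"
  shows "A \<bullet> (A - transpose A) = (norm (A - transpose A))\<^sup>2 / 2"
proof -
  have 1: "transpose A \<bullet> A = A \<bullet> transpose A"
    by (rule inner_commute)
  show ?thesis
    unfolding power2_norm_eq_inner inner_diff_left inner_diff_right inner_transpose 1 by simp
qed

lemma transpose_diff_transpose: "transpose (A - transpose A) = - (A - transpose A)"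
  for A :: "real ^ 'm::finite ^ 'm"
  by (simp add: transpose_linear_simps)

text \<open>The identity is perturbed along \<open>exp (s (A - A\<^sup>T))\<close> for small \<open>s\<close> here, and by reflections for
  the companion bound on the quadratic form.\<close>

lemma symmetric_if_locally_optimal:
  fixes A :: "real ^ 'm::finite ^ 'm"
  assumes opt: "\<And>R. orthogonal_matrix R \<Longrightarrow> A \<bullet> (R - mat 1) \<le> c * (norm (R - mat 1))\<^sup>2"
  shows "transpose A = A"
proof -
  define E where "E = A - transpose A"
  have skew: "transpose (s *\<^sub>R E) = - (s *\<^sub>R E)" for s
    by (simp add: transpose_linear_simps E_def scaleR_diff_right)
  \<comment> \<open>\<open>K\<close> collects the second-order losses: the slack \<open>c\<close> in
    the optimality and the Taylor remainder. The gain \<open>s * (A \<bullet> E)\<close> is linear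
    in \<open>s\<close>, so small positive \<open>s\<close> will force \<open>E = 0\<close>.\<close>
  define K where "K = \<bar>c\<bar> + norm A / 2"
  have "s * ((norm E)\<^sup>2 / 2) \<le> s\<^sup>2 * (K * (norm E)\<^sup>2)" for s :: real
  proof -
    define R where "R = mat_exp (s *\<^sub>R E)"
    have "A \<bullet> (R - mat 1) \<le> c * (norm (R - mat 1))\<^sup>2"
      unfolding R_def by (rule opt[OF orthogonal_mat_exp[OF skew]])
    also have "\<dots> \<le> \<bar>c\<bar> * (norm (R - mat 1))\<^sup>2"
      by (rule mult_right_mono) auto
    also have "\<dots> \<le> \<bar>c\<bar> * (norm (s *\<^sub>R E))\<^sup>2"
      unfolding R_def by (intro mult_left_mono power_mono norm_mat_exp_diff_le skew) auto
    finally have 1: "A \<bullet> (R - mat 1) \<le> \<bar>c\<bar> * (norm (s *\<^sub>R E))\<^sup>2" .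
    have 2: "\<bar>A \<bullet> (R - mat 1 - s *\<^sub>R E)\<bar> \<le> norm A * (norm (s *\<^sub>R E))\<^sup>2 / 2"
      unfolding R_def by (rule inner_mat_exp_remainder_le[OF skew])
    have 3: "A \<bullet> E = (norm E)\<^sup>2 / 2"
      unfolding E_def by (rule inner_self_diff_transpose)
    have "s * (A \<bullet> E) = A \<bullet> (R - mat 1) - A \<bullet> (R - mat 1 - s *\<^sub>R E)"
      by (simp add: inner_diff_right)
    also have "\<dots> \<le> K * (norm (s *\<^sub>R E))\<^sup>2"
      using 1 2 by (simp add: K_def distrib_right)
    finally show ?thesis
      by (simp add: 3 power_mult_distrib mult_ac)
  qed
  note key = this
  have "norm E = 0"
  proof (rule ccontr)
    assume "norm E \<noteq> 0"
    then have pos: "(norm E)\<^sup>2 > 0" by simp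
    have "K \<ge> 0" by (simp add: K_def)
    \<comment> \<open>Small enough for \<open>s * K\<close> to stay below \<open>1 / 2\<close>; the
      added 1 keeps the quotient meaningful for \<open>K = 0\<close>.\<close>
    define s where "s = 1 / (4 * (K + 1))"
    have "s > 0" and "s * K \<le> 1 / 4"
      using \<open>K \<ge> 0\<close> by (simp_all add: s_def divide_simps)
    have "(s * (norm E)\<^sup>2) * (1 / 2) \<le> (s * (norm E)\<^sup>2) * (s * K)"
      using key[of s] by (simp add: power2_eq_square mult_ac)
    then have "1 / 2 \<le> s * K"
      using pos \<open>s > 0\<close> by (simp add: mult_le_cancel_left)
    with \<open>s * K \<le> 1 / 4\<close> show False by simp
  qed
  then show ?thesis by (simp add: E_def)
qed

definition outer :: "real ^ 'm::finite \<Rightarrow> real ^ 'm ^ 'm" where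
  "outer v = (\<chi> i j. v $ i * v $ j)"

lemma inner_outer: "A \<bullet> outer v = v \<bullet> (A *v v)"
  by (simp add: inner_matrix_eq_sum outer_def inner_vec_def matrix_vector_mult_def sum_distrib_left mult_ac)

lemma outer_mult_outer: "outer v ** outer v = (v \<bullet> v) *\<^sub>R outer v"
  by (simp add: vec_eq_iff outer_def matrix_matrix_mult_def inner_vec_def sum_distrib_left sum_distrib_right mult_ac)

lemma transpose_outer: "transpose (outer v) = outer v"
  by (simp add: vec_eq_iff outer_def transpose_def mult.commute)

lemma quadratic_form_ge_if_locally_optimal:
  fixes A :: "real ^ 'm::finite ^ 'm"
  assumes opt: "\<And>R. orthogonal_matrix R \<Longrightarrow> A \<bullet> (R - mat 1) \<le> c * (norm (R - mat 1))\<^sup>2"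
  shows "v \<bullet> (A *v v) \<ge> - 2 * c * (norm v)\<^sup>2"
proof (cases "v = 0")
  case False
  define r where "r = v \<bullet> v"
  have r: "r > 0" using False by (simp add: r_def)
  \<comment> \<open>The Householder reflection along \<open>v\<close>. Its distance to the identity
    is 2 for every \<open>v\<close>, which produces the factor \<open>2 * c\<close>.\<close>
  define R where "R = mat 1 - (2 / r) *\<^sub>R outer v"
  have "transpose R ** R = mat 1"
    using r unfolding R_def
    by (simp add: transpose_linear_simps transpose_outer matrix_mult_simps outer_mult_outer
        scaleR_diff_right scaleR_2 flip: r_def)
  then have "A \<bullet> (R - mat 1) \<le> c * (norm (R - mat 1))\<^sup>2"
    by (intro opt) (simp add: orthogonal_matrix)
  moreover have "(norm (outer v))\<^sup>2 = r\<^sup>2"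
  proof -
    have "outer v *v v = r *\<^sub>R v"
      unfolding r_def
      by (simp add: vec_eq_iff outer_def matrix_vector_mult_def inner_vec_def sum_distrib_left mult_ac)
    then have "outer v \<bullet> outer v = r * r"
      by (simp only: inner_outer inner_scaleR_right r_def)
    then show ?thesis
      unfolding power2_norm_eq_inner power2_eq_square[of r] .
  qed
  moreover have "R - mat 1 = (- (2 / r)) *\<^sub>R outer v"
    by (simp add: R_def)
  ultimately have "- (2 / r) * (v \<bullet> (A *v v)) \<le> c * ((2 / r)\<^sup>2 * r\<^sup>2)"
    by (simp only: norm_scaleR power_mult_distrib power2_abs power2_minus inner_scaleR_right inner_outer)
  moreover have "(2 / r)\<^sup>2 * r\<^sup>2 = 4"
    using r by (simp add: power_divide)
  ultimately have "- (2 / r) * (v \<bullet> (A *v v)) \<le> c * 4"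
    by (simp only:)
  then have "- (v \<bullet> (A *v v)) \<le> 2 * c * r"
    using mult_left_mono[of "- (2 / r) * (v \<bullet> (A *v v))" "c * 4" "r / 2"] r by simp
  then show ?thesis unfolding r_def power2_norm_eq_inner by simp
qed simp

section \<open>The objective as a quadratic form\<close>

lemma fbar_eq_inner: "fbar C G = G \<bullet> (C ** G)"
  by (simp add: fbar_def inner_eq_trace matrix_mul_assoc)

lemma fbar_add:
  assumes "transpose C = C"
  shows "fbar C (G + D) = fbar C G + 2 * ((C ** G) \<bullet> D) + D \<bullet> (C ** D)"
proof -
  have "G \<bullet> (C ** D) = (C ** G) \<bullet> D"
    unfolding inner_mult_left assms ..
  moreover have "fbar C (G + D) = G \<bullet> (C ** G) + G \<bullet> (C ** D) + (D \<bullet> (C ** G) + D \<bullet> (C ** D))"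
    unfolding fbar_eq_inner matrix_mult_simps(2) inner_add_left inner_add_right by simp
  ultimately show ?thesis
    using inner_commute[of D "C ** G"] unfolding fbar_eq_inner by linarith
qed

lemma transpose_signal_plus_noise:
  fixes Gs :: "real ^ 'd::finite ^ 'm::finite"
  assumes C: "C = Gs ** transpose Gs + \<Delta>" and sym: "transpose \<Delta> = \<Delta>"
  shows "transpose C = C"
  unfolding C transpose_linear_simps(1) matrix_transpose_mul sym transpose_transpose ..

text \<open>The signal contributes the square of \<open>norm (transpose Gs ** D)\<close>, so only
  the noise can make the form negative.\<close>

lemma inner_signal_plus_noise_ge:
  fixes Gs :: "real ^ 'd::finite ^ 'm::finite" and D :: "real ^ 'k::finite ^ 'm"
  assumes "C = Gs ** transpose Gs + \<Delta>"
  shows "D \<bullet> (C ** D) \<ge> - opnorm \<Delta> * (norm D)\<^sup>2"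
proof -
  have "D \<bullet> (Gs ** (transpose Gs ** D)) = (norm (transpose Gs ** D))\<^sup>2"
    unfolding power2_norm_eq_inner by (rule inner_mult_left)
  then have "0 \<le> D \<bullet> (Gs ** (transpose Gs ** D))"
    by (metis zero_le_power2)
  moreover have "D \<bullet> (C ** D) = D \<bullet> (Gs ** (transpose Gs ** D)) + D \<bullet> (\<Delta> ** D)"
    unfolding assms matrix_mult_simps(1) inner_add_right matrix_mul_assoc ..
  moreover have "\<bar>D \<bullet> (\<Delta> ** D)\<bar> \<le> norm D * norm (\<Delta> ** D)"
    by (rule Cauchy_Schwarz_ineq2)
  moreover have "norm D * norm (\<Delta> ** D) \<le> norm D * (opnorm \<Delta> * norm D)"
    by (intro mult_left_mono norm_matrix_mult_opnorm_le norm_ge_zero)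
  moreover have "norm D * (opnorm \<Delta> * norm D) = opnorm \<Delta> * (norm D)\<^sup>2"
    by (simp add: power2_eq_square)
  ultimately show ?thesis by linarith
qed

lemma block_orthogonalD: "G \<in> block_orthogonal \<Longrightarrow> orthogonal_matrix (block G i)"
  by (simp add: block_orthogonal_def)

lemma norm_orthogonal_matrix:
  fixes Q :: "real ^ 'd::finite ^ 'd"
  assumes "orthogonal_matrix Q"
  shows "norm Q = sqrt (real CARD('d))"
proof -
  have "(norm Q)\<^sup>2 = real CARD('d)"
    using assms by (simp add: norm_matrix_sq orthogonal_matrix_def trace_def mat_def)
  then show ?thesis by (metis norm_ge_zero real_sqrt_unique)
qed

lemma norm_block_orthogonal:
  fixes G :: "('n::finite, 'd::finite) blockcol"
  assumes "G \<in> block_orthogonal"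
  shows "(norm G)\<^sup>2 = real CARD('n) * real CARD('d)"
  unfolding norm_sq_blocks
  by (simp add: norm_orthogonal_matrix block_orthogonalD[OF assms])

lemma transpose_mult_self_block_orthogonal:
  fixes G :: "('n::finite, 'd::finite) blockcol"
  assumes "G \<in> block_orthogonal"
  shows "transpose G ** G = real CARD('n) *\<^sub>R mat 1"
  using block_orthogonalD[OF assms]
  by (simp add: transpose_mult_blocks orthogonal_matrix_def sum_constant_scaleR
      del: sum_constant)

text \<open>The gradient in coordinates at the identity: twice the skew part of the block of
  \<open>C ** G\<close> seen from \<open>G\<close>. A gradient step exponentiates exactly this
  matrix, scaled by the step size.\<close>

definition skew_grad ::
    "('n::finite, 'd::finite) blockmat \<Rightarrow> ('n, 'd) blockcol \<Rightarrow> 'n \<Rightarrow> real ^ 'd ^ 'd" where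
  "skew_grad C G i = transpose (block G i) ** (block C i ** G)
     - transpose (transpose (block G i) ** (block C i ** G))"

lemma block_rgrad:
  assumes "G \<in> block_orthogonal"
  shows "block (rgrad C G) i = block G i ** skew_grad C G i"
  using block_orthogonalD[OF assms, of i]
  by (simp add: rgrad_def skew_grad_def matrix_mult_simps matrix_transpose_mul matrix_mul_assoc
      orthogonal_matrix_def)

lemma transpose_skew_grad: "transpose (skew_grad C G i) = - skew_grad C G i"
  unfolding skew_grad_def by (rule transpose_diff_transpose)

lemma norm_rgrad_sq:
  assumes "G \<in> block_orthogonal"
  shows "(norm (rgrad C G))\<^sup>2 = (\<Sum>i\<in>UNIV. (norm (skew_grad C G i))\<^sup>2)"
  unfolding norm_sq_blocks
  by (simp add: block_rgrad norm_orthogonal_mult_left block_orthogonalD assms)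

lemma block_Exp_map_rgrad:
  assumes "G \<in> block_orthogonal"
  shows "block (Exp_map G (t *\<^sub>R rgrad C G)) i = block G i ** mat_exp (t *\<^sub>R skew_grad C G i)"
  using block_orthogonalD[OF assms, of i]
  by (simp add: Exp_map_def block_rgrad assms matrix_mult_simps matrix_mul_assoc orthogonal_matrix_def)

lemma norm_Exp_map_rgrad_diff_le:
  assumes "G \<in> block_orthogonal" "0 \<le> t"
  shows "norm (Exp_map G (t *\<^sub>R rgrad C G) - G) \<le> t * norm (rgrad C G)"
proof (rule norm_le_by_blocks[OF _ assms(2)])
  fix i
  have "block (Exp_map G (t *\<^sub>R rgrad C G) - G) i = block G i ** (mat_exp (t *\<^sub>R skew_grad C G i) - mat 1)"
    by (simp add: block_Exp_map_rgrad assms matrix_mult_simps)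
  moreover have "norm (mat_exp (t *\<^sub>R skew_grad C G i) - mat 1) \<le> norm (t *\<^sub>R skew_grad C G i)"
    by (rule norm_mat_exp_diff_le) (simp add: transpose_linear_simps transpose_skew_grad)
  ultimately show "norm (block (Exp_map G (t *\<^sub>R rgrad C G) - G) i) \<le> t * norm (block (rgrad C G) i)"
    using assms by (simp add: norm_orthogonal_mult_left block_orthogonalD block_rgrad)
qed

lemma block_signal_mult:
  fixes Gs :: "real ^ 'd::finite ^ ('n::finite \<times> 'd)"
  assumes "C = Gs ** transpose Gs + \<Delta>"
  shows "block C i ** G = block Gs i ** (transpose Gs ** G) + block (\<Delta> ** G) i"
  unfolding assms by (simp add: matrix_mult_simps matrix_mul_assoc)

text \<open>The expansion of \<open>fbar\<close> around \<open>G\<close> is exact. Its linear term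
  gains \<open>t\<close> and loses at most \<open>m * t^2\<close>, where \<open>m\<close> bounds the
  blocks of \<open>C ** G\<close>; its quadratic term loses at most
  \<open>opnorm \<Delta> * t^2\<close>, all in units of the squared gradient norm.\<close>

lemma ascent:
  fixes G Gs :: "('n::finite, 'd::finite) blockcol"
  assumes G: "G \<in> block_orthogonal" and Gs: "Gs \<in> block_orthogonal"
    and C: "C = Gs ** transpose Gs + \<Delta>" and sym: "transpose \<Delta> = \<Delta>" and t: "0 \<le> t"
  shows "fbar C (Exp_map G (t *\<^sub>R rgrad C G)) - fbar C G \<ge>
    t * (norm (rgrad C G))\<^sup>2 *
      (1 - t * (real CARD('n) * real CARD('d) + opnorm \<Delta> + norm_inf (\<Delta> ** G)))"
proof -
  define X where "X = Exp_map G (t *\<^sub>R rgrad C G)"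
  define D where "D = X - G"
  define m where "m = real CARD('n) * real CARD('d) + norm_inf (\<Delta> ** G)"
  define g where "g = (norm (rgrad C G))\<^sup>2"
  have f: "fbar C X = fbar C G + 2 * ((C ** G) \<bullet> D) + D \<bullet> (C ** D)"
    using fbar_add[OF transpose_signal_plus_noise[OF C sym], of G D] by (simp add: D_def)
  have "(norm D)\<^sup>2 \<le> (t * norm (rgrad C G))\<^sup>2"
    unfolding D_def X_def by (intro power_mono norm_Exp_map_rgrad_diff_le G t norm_ge_zero)
  then have "opnorm \<Delta> * (norm D)\<^sup>2 \<le> opnorm \<Delta> * (t\<^sup>2 * g)"
    by (intro mult_left_mono opnorm_nonneg) (simp add: g_def power_mult_distrib)
  with inner_signal_plus_noise_ge[OF C, of D]
  have quad: "D \<bullet> (C ** D) \<ge> - opnorm \<Delta> * (t\<^sup>2 * g)" by simp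
  \<comment> \<open>This Frobenius estimate of the overlap is the source of the product
    \<open>n d\<close> in the ascent bound.\<close>
  have "norm (transpose Gs ** G) \<le> norm Gs * norm G"
    using norm_matrix_mult_le[of "transpose Gs" G] by simp
  also have "\<dots> = real CARD('n) * real CARD('d)"
    using norm_block_orthogonal[OF G] norm_block_orthogonal[OF Gs]
    by (metis norm_ge_zero power2_eq_imp_eq power2_eq_square)
  finally have GsG: "norm (transpose Gs ** G) \<le> real CARD('n) * real CARD('d)" .
  have CG: "norm (block C i ** G) \<le> m" for i
    unfolding block_signal_mult[OF C] m_def
    by (rule norm_triangle_le, rule add_mono)
      (use GsG in \<open>simp_all add: norm_orthogonal_mult_left block_orthogonalD[OF Gs] norm_block_le_norm_inf del: block_mult\<close>)
  have "(C ** G) \<bullet> D \<ge> (\<Sum>i\<in>UNIV. (t / 2 - m * t\<^sup>2 / 2) * (norm (skew_grad C G i))\<^sup>2)"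
    unfolding inner_blocks[of "C ** G"]
  proof (rule sum_mono)
    fix i :: 'n
    define A where "A = transpose (block G i) ** (block C i ** G)"
    define S where "S = skew_grad C G i"
    have S: "S = A - transpose A" by (simp add: S_def A_def skew_grad_def)
    have nA: "norm A \<le> m"
      using CG[of i] by (simp add: A_def norm_orthogonal_mult_left block_orthogonalD[OF G])
    have "block (C ** G) i \<bullet> block D i = A \<bullet> (mat_exp (t *\<^sub>R S) - mat 1)"
    proof -
      have "block D i = block G i ** (mat_exp (t *\<^sub>R S) - mat 1)"
        by (simp add: D_def X_def block_Exp_map_rgrad G matrix_mult_simps S_def)
      then show ?thesis by (simp add: inner_mult_left A_def)
    qed
    also have "\<dots> = t * (A \<bullet> S) + A \<bullet> (mat_exp (t *\<^sub>R S) - mat 1 - t *\<^sub>R S)"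
      by (simp add: inner_diff_right)
    also have "A \<bullet> S = (norm S)\<^sup>2 / 2"
      unfolding S by (rule inner_self_diff_transpose)
    finally have 1: "block (C ** G) i \<bullet> block D i =
      t * ((norm S)\<^sup>2 / 2) + A \<bullet> (mat_exp (t *\<^sub>R S) - mat 1 - t *\<^sub>R S)" .
    have "\<bar>A \<bullet> (mat_exp (t *\<^sub>R S) - mat 1 - t *\<^sub>R S)\<bar> \<le> norm A * (norm (t *\<^sub>R S))\<^sup>2 / 2"
      by (rule inner_mat_exp_remainder_le) (simp add: S transpose_linear_simps scaleR_diff_right)
    also have "\<dots> \<le> m * (norm (t *\<^sub>R S))\<^sup>2 / 2"
      using nA by (simp add: mult_right_mono)
    finally have "\<bar>A \<bullet> (mat_exp (t *\<^sub>R S) - mat 1 - t *\<^sub>R S)\<bar> \<le> m * t\<^sup>2 / 2 * (norm S)\<^sup>2"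
      by (simp add: power_mult_distrib)
    then have "- (m * t\<^sup>2 / 2 * (norm S)\<^sup>2) \<le> A \<bullet> (mat_exp (t *\<^sub>R S) - mat 1 - t *\<^sub>R S)"
      by linarith
    moreover have "(t / 2 - m * t\<^sup>2 / 2) * (norm S)\<^sup>2 = t * ((norm S)\<^sup>2 / 2) - m * t\<^sup>2 / 2 * (norm S)\<^sup>2"
      by (simp add: left_diff_distrib)
    ultimately show "(t / 2 - m * t\<^sup>2 / 2) * (norm (skew_grad C G i))\<^sup>2 \<le> block (C ** G) i \<bullet> block D i"
      unfolding 1 S_def[symmetric] by linarith
  qed
  then have "(C ** G) \<bullet> D \<ge> (t / 2 - m * t\<^sup>2 / 2) * g"
    by (simp add: g_def norm_rgrad_sq G sum_distrib_left)
  with quad f have "fbar C X - fbar C G \<ge> 2 * ((t / 2 - m * t\<^sup>2 / 2) * g) - opnorm \<Delta> * (t\<^sup>2 * g)"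
    by simp
  moreover have "2 * ((t / 2 - m * t\<^sup>2 / 2) * g) - opnorm \<Delta> * (t\<^sup>2 * g) =
      t * g * (1 - t * (real CARD('n) * real CARD('d) + opnorm \<Delta> + norm_inf (\<Delta> ** G)))"
    by (simp add: m_def algebra_simps power2_eq_square[of t])
  ultimately show ?thesis
    unfolding X_def g_def by (simp only:)
qed

section \<open>Aligned block columns and symmetric matrices\<close>

text \<open>Row by row, \<open>X \<bullet> (X ** P)\<close> is a sum of values of the quadratic form
  of \<open>P\<close>.\<close>

lemma norm_row_mult_quadratic_ge:
  fixes X :: "real ^ 'k::finite ^ 'm::finite" and P :: "real ^ 'k ^ 'k"
  assumes "\<And>v. v \<bullet> (P *v v) \<ge> c * (norm v)\<^sup>2"
  shows "X \<bullet> (X ** P) \<ge> c * (norm X)\<^sup>2"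
proof -
  have "X \<bullet> (X ** P) = (\<Sum>i\<in>UNIV. row i X \<bullet> row i (X ** P))"
    by (simp add: inner_matrix_eq_sum inner_vec_def row_def)
  also have "\<dots> = (\<Sum>i\<in>UNIV. row i X \<bullet> (P *v row i X))"
  proof (intro sum.cong refl)
    fix i
    have "row i (X ** P) = row i X v* P"
      by (simp add: vec_eq_iff row_def matrix_matrix_mult_def vector_matrix_mult_def mult.commute)
    then show "row i X \<bullet> row i (X ** P) = row i X \<bullet> (P *v row i X)"
      by (metis dot_lmul_matrix inner_commute)
  qed
  also have "\<dots> \<ge> (\<Sum>i\<in>UNIV. c * (norm (row i X))\<^sup>2)"
    by (intro sum_mono assms)
  finally show ?thesis
    by (simp add: norm_sq_rows[of X] sum_distrib_left)
qed

section \<open>Quadratic forms of symmetric matrices\<close>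

lemma inner_symmetric_matrix_vector:
  fixes S :: "real ^ 'k::finite ^ 'k"
  assumes "transpose S = S"
  shows "x \<bullet> (S *v y) = (S *v x) \<bullet> y"
  by (metis assms dot_lmul_matrix transpose_matrix_vector)

text \<open>In the order of symmetric matrices this says that the square of \<open>T\<close> is at
  most \<open>K\<close> times \<open>T\<close>. It follows without eigenvalues by testing positivity
  at \<open>K *\<^sub>R v - T *v v\<close>.\<close>

lemma quadratic_form_ge_of_psd:
  fixes T :: "real ^ 'k::finite ^ 'k"
  assumes sym: "transpose T = T" and psd: "\<And>v. v \<bullet> (T *v v) \<ge> 0"
    and K: "\<And>v. norm (T *v v) \<le> K * norm v" "K > 0"
  shows "(norm (T *v v))\<^sup>2 \<le> K * (v \<bullet> (T *v v))"
proof -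
  define y where "y = T *v v"
  have vTy: "v \<bullet> (T *v y) = y \<bullet> y"
    using inner_symmetric_matrix_vector[OF sym, of v y] by (simp add: y_def)
  have "y \<bullet> (T *v y) \<le> norm y * (K * norm y)"
    by (rule order_trans[OF norm_cauchy_schwarz]) (intro mult_left_mono K norm_ge_zero)
  then have yTy: "y \<bullet> (T *v y) \<le> K * (y \<bullet> y)"
    by (simp add: power2_norm_eq_inner[symmetric] power2_eq_square mult.left_commute)
  have "T *v (K *\<^sub>R v - y) = K *\<^sub>R y - T *v y"
    by (simp add: matrix_vector_mult_diff_distrib matrix_vector_mult_scaleR y_def)
  then have "0 \<le> (K *\<^sub>R v - y) \<bullet> (K *\<^sub>R y - T *v y)"
    using psd[of "K *\<^sub>R v - y"] by simp
  also have "\<dots> = K * (K * (v \<bullet> y)) - K * (y \<bullet> y) - K * (y \<bullet> y) + y \<bullet> (T *v y)"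
    by (simp add: inner_diff_left inner_diff_right vTy algebra_simps)
  also have "\<dots> \<le> K * (K * (v \<bullet> y) - y \<bullet> y)"
    using yTy by (simp add: algebra_simps)
  finally have "0 \<le> K * (v \<bullet> y) - y \<bullet> y"
    using K(2) by (simp add: zero_le_mult_iff)
  then show ?thesis
    by (simp add: y_def power2_norm_eq_inner)
qed

text \<open>A cheap substitute for diagonalizing \<open>S\<close>, which would give the constant \<open>m\<close>.\<close>

lemma quadratic_form_ge_of_gap:
  fixes S :: "real ^ 'k::finite ^ 'k"
  assumes sym: "transpose S = S"
    and low: "\<And>v. m * norm v \<le> norm (S *v v)" and up: "\<And>v. norm (S *v v) \<le> M * norm v"
    and psd: "\<And>v. v \<bullet> (S *v v) \<ge> - \<epsilon> * (norm v)\<^sup>2"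
    and "0 \<le> \<epsilon>" "\<epsilon> \<le> m" "0 < M"
  shows "v \<bullet> (S *v v) \<ge> ((m - \<epsilon>)\<^sup>2 / (M + \<epsilon>) - \<epsilon>) * (norm v)\<^sup>2"
proof -
  \<comment> \<open>The shift by \<epsilon> makes the form positive and moves the bounds on the norm
    to \<open>m - \<epsilon>\<close> and \<open>M + \<epsilon>\<close>; it is undone at the
    end.\<close>
  define T where "T = S + \<epsilon> *\<^sub>R mat 1"
  have Tv: "T *v x = S *v x + \<epsilon> *\<^sub>R x" for x
    by (simp add: T_def matrix_vector_mult_add_rdistrib flip: scaleR_matrix_vector_assoc)
  have vTv: "x \<bullet> (T *v x) = x \<bullet> (S *v x) + \<epsilon> * (norm x)\<^sup>2" for x
    by (simp add: Tv inner_add_right power2_norm_eq_inner)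
  have "norm (T *v x) \<le> (M + \<epsilon>) * norm x" for x
    using norm_triangle_ineq[of "S *v x" "\<epsilon> *\<^sub>R x"] up[of x] \<open>0 \<le> \<epsilon>\<close>
    by (simp add: Tv distrib_right)
  then have "(norm (T *v v))\<^sup>2 \<le> (M + \<epsilon>) * (v \<bullet> (T *v v))"
  proof (intro quadratic_form_ge_of_psd)
    show "transpose T = T"
      by (simp add: T_def transpose_linear_simps sym)
    show "0 \<le> x \<bullet> (T *v x)" for x
      using psd[of x] by (simp add: vTv)
  qed (use assms(5,7) in simp_all)
  moreover have "(m - \<epsilon>) * norm v \<le> norm (T *v v)"
    using norm_triangle_ineq4[of "T *v v" "\<epsilon> *\<^sub>R v"] low[of v] \<open>0 \<le> \<epsilon>\<close>
    by (simp add: Tv left_diff_distrib)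
  then have "((m - \<epsilon>) * norm v)\<^sup>2 \<le> (norm (T *v v))\<^sup>2"
    using assms(6) by (intro power_mono) auto
  ultimately have "(m - \<epsilon>)\<^sup>2 * (norm v)\<^sup>2 \<le> (M + \<epsilon>) * (v \<bullet> (T *v v))"
    by (simp add: power_mult_distrib)
  then have "(m - \<epsilon>)\<^sup>2 / (M + \<epsilon>) * (norm v)\<^sup>2 \<le> v \<bullet> (T *v v)"
    using assms(5,7) by (simp add: field_simps)
  then show ?thesis
    by (simp add: vTv left_diff_distrib)
qed

text \<open>Since \<open>norm (Y ** R)\<close> does not vary with \<open>R\<close>, minimal distance
  at \<open>R = mat 1\<close> means that \<open>transpose Y ** X\<close> has its largest pairing
  with an orthogonal matrix there. Both optimality lemmas then apply with
  \<open>c = 0\<close>.\<close>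

lemma procrustes:
  fixes X Y :: "('n::finite, 'd::finite) blockcol"
  assumes X: "X \<in> block_orthogonal" and Y: "Y \<in> block_orthogonal"
    and opt: "\<And>R. orthogonal_matrix R \<Longrightarrow> norm (X - Y) \<le> norm (X - Y ** R)"
  shows "transpose (transpose Y ** X) = transpose Y ** X"
    and "v \<bullet> ((transpose Y ** X) *v v) \<ge> 0"
proof -
  have "(transpose Y ** X) \<bullet> (R - mat 1) \<le> 0 * (norm (R - mat 1))\<^sup>2"
    if R: "orthogonal_matrix R" for R
  proof -
    have "(norm (X - Y))\<^sup>2 \<le> (norm (X - Y ** R))\<^sup>2"
      using opt[OF R] by (intro power_mono) auto
    moreover have "(norm (X - Z))\<^sup>2 = (norm X)\<^sup>2 - 2 * (X \<bullet> Z) + (norm Z)\<^sup>2" for Z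
      by (simp add: power2_norm_eq_inner inner_diff_left inner_diff_right inner_commute[of Z X])
    ultimately have "X \<bullet> (Y ** R) \<le> X \<bullet> Y"
      using norm_orthogonal_mult_right[OF R, of Y] by simp
    then show ?thesis
      by (simp add: inner_diff_right flip: inner_mult_left)
  qed
  from symmetric_if_locally_optimal[OF this] quadratic_form_ge_if_locally_optimal[OF this, of v]
  show "transpose (transpose Y ** X) = transpose Y ** X" "v \<bullet> ((transpose Y ** X) *v v) \<ge> 0"
    by simp_all
qed

text \<open>By symmetry the two mixed terms in the Gram matrix of \<open>X - Y\<close> agree.
  Consequently \<open>transpose Y ** (X - Y)\<close> is of second order in the difference, which
  keeps the signal part of \<open>C\<close> small on it.\<close>

lemma transpose_mult_diff_aligned:
  fixes X Y :: "('n::finite, 'd::finite) blockcol"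
  assumes X: "X \<in> block_orthogonal" and Y: "Y \<in> block_orthogonal"
    and sym: "transpose (transpose Y ** X) = transpose Y ** X"
  shows "transpose Y ** X = real CARD('n) *\<^sub>R mat 1 - (1 / 2) *\<^sub>R (transpose (X - Y) ** (X - Y))"
    and "transpose Y ** (X - Y) = - (1 / 2) *\<^sub>R (transpose (X - Y) ** (X - Y))"
proof -
  have "transpose X ** Y = transpose Y ** X"
    using sym by (simp add: matrix_transpose_mul)
  then have "transpose (X - Y) ** (X - Y) =
      (real CARD('n) *\<^sub>R mat 1 - transpose Y ** X) + (real CARD('n) *\<^sub>R mat 1 - transpose Y ** X)"
    by (simp add: transpose_linear_simps matrix_mult_simps transpose_mult_self_block_orthogonal X Y)
  also have "\<dots> = 2 *\<^sub>R (real CARD('n) *\<^sub>R mat 1 - transpose Y ** X)"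
    by (rule scaleR_2[symmetric])
  finally have "transpose (X - Y) ** (X - Y) = 2 *\<^sub>R (real CARD('n) *\<^sub>R mat 1 - transpose Y ** X)" .
  then show "transpose Y ** X = real CARD('n) *\<^sub>R mat 1 - (1 / 2) *\<^sub>R (transpose (X - Y) ** (X - Y))"
    by simp
  then show "transpose Y ** (X - Y) = - (1 / 2) *\<^sub>R (transpose (X - Y) ** (X - Y))"
    by (simp add: matrix_mult_simps transpose_mult_self_block_orthogonal Y)
qed

lemma norm_block_orthogonal_mult:
  fixes G :: "('n::finite, 'd::finite) blockcol" and Y :: "real ^ 'l::finite ^ 'd"
  assumes "G \<in> block_orthogonal"
  shows "norm (G ** Y) = sqrt (real CARD('n)) * norm Y"
proof (rule power2_eq_imp_eq)
  show "(norm (G ** Y))\<^sup>2 = (sqrt (real CARD('n)) * norm Y)\<^sup>2"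
    by (simp add: norm_sq_blocks norm_orthogonal_mult_left block_orthogonalD assms power_mult_distrib)
qed auto

text \<open>The pairing with \<open>X\<close> exposes a quadratic form of \<open>S\<close>, to which
  definiteness can be applied. The mixed terms agree by transposition;
  \<open>(S ** R) \<bullet> R\<close> and \<open>R \<bullet> (R ** S)\<close> are both the trace of
  \<open>S\<close>.\<close>

lemma inner_commutator_orthogonal:
  fixes R S :: "real ^ 'd::finite ^ 'd"
  assumes R: "orthogonal_matrix R" and S: "transpose S = S"
  defines "X \<equiv> transpose R - R"
  shows "(transpose R ** S - S ** R) \<bullet> X = X \<bullet> (X ** S)"
proof -
  have e: "R \<bullet> (transpose R ** S) = (transpose R ** S) \<bullet> R"
    by (rule inner_commute)
  have c: "transpose R \<bullet> (R ** S) = (transpose R ** S) \<bullet> R"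
  proof -
    have "transpose R \<bullet> (R ** S) = (transpose R ** transpose S) \<bullet> R"
      by (rule inner_mult_right)
    then show ?thesis by (simp add: S)
  qed
  have f: "(S ** R) \<bullet> transpose R = (transpose R ** S) \<bullet> R"
    using inner_transpose[of "S ** R" "transpose R"] by (simp add: matrix_transpose_mul S)
  have a: "(S ** R) \<bullet> R = R \<bullet> (R ** S)"
  proof -
    have "(S ** R) \<bullet> R = (R ** transpose R) \<bullet> S"
      by (metis inner_commute inner_mult_right)
    moreover have "R \<bullet> (R ** S) = (transpose R ** R) \<bullet> S"
      by (rule inner_mult_left)
    ultimately show ?thesis
      using R by (simp add: orthogonal_matrix_def)
  qed
  show ?thesis
    unfolding X_def matrix_mult_simps inner_diff_left inner_diff_right e c f
    using a inner_commute[of "transpose R ** S" "transpose R"] by simp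
qed

text \<open>Multiplication by \<open>R\<close> turns the difference into
  \<open>mat 1 - R ** R\<close>, which is \<open>- (2 *\<^sub>R K + K ** K)\<close> for
  \<open>K = R - mat 1\<close>. Near the identity a rotation is thus controlled by its skew part; a
  reflection, at distance 2, has none.\<close>

lemma norm_orthogonal_diff_transpose_ge:
  fixes R :: "real ^ 'd::finite ^ 'd"
  assumes R: "orthogonal_matrix R"
  shows "norm (transpose R - R) \<ge> (2 - norm (R - mat 1)) * norm (R - mat 1)"
proof -
  define K where "K = R - mat 1"
  have "norm (transpose R - R) = norm (R ** (transpose R - R))"
    by (simp add: norm_orthogonal_mult_left R)
  also have "R ** (transpose R - R) = - (2 *\<^sub>R K + K ** K)"
    using R by (simp add: K_def matrix_mult_simps orthogonal_matrix_def scaleR_2)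
  also have "norm (- (2 *\<^sub>R K + K ** K)) = norm (2 *\<^sub>R K + K ** K)"
    by (rule norm_minus_cancel)
  also have "norm (2 *\<^sub>R K + K ** K) \<ge> norm (2 *\<^sub>R K) - norm (K ** K)"
    by (rule norm_diff_ineq)
  finally show ?thesis
    using norm_matrix_mult_le[of K K] by (simp add: K_def left_diff_distrib)
qed

section \<open>Gradient domination near the maximizer\<close>

text \<open>Alignment loses no generality, as \<open>Gs\<close> enters \<open>C\<close> only through \<open>Gs Gs\<^sup>T\<close>.\<close>

locale aligned_optimum =
  fixes Gs Gh :: "('n::finite, 'd::finite) blockcol" and \<Delta> C :: "('n, 'd) blockmat"
    and n d q :: real
  defines "n \<equiv> real CARD('n)" and "d \<equiv> real CARD('d)" and "q \<equiv> n powr (1 / 4)"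
  assumes Gs: "Gs \<in> block_orthogonal" and Gh: "Gh \<in> block_orthogonal"
    and sym: "transpose \<Delta> = \<Delta>" and C: "C = Gs ** transpose Gs + \<Delta>"
    and opt: "\<And>H. H \<in> block_orthogonal \<Longrightarrow> fbar C H \<le> fbar C Gh"
    and opnorm_le: "opnorm \<Delta> \<le> n powr (3 / 4) / (20 * sqrt d)"
    and noise_le: "norm_inf (\<Delta> ** Gs) \<le> n / 20"
    and aligned: "\<And>R. orthogonal_matrix R \<Longrightarrow> norm (Gh - Gs) \<le> norm (Gh - Gs ** R)"
begin

section \<open>Size of the noise in powers of \<open>q\<close>\<close>

lemma n_ge_1: "n \<ge> 1" and d_ge_1: "d \<ge> 1"
  by (simp_all add: n_def d_def Suc_le_eq)

lemma norm_sq_orthogonal: "G \<in> block_orthogonal \<Longrightarrow> (norm G)\<^sup>2 = n * d"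
  for G :: "('n, 'd) blockcol"
  unfolding n_def d_def by (rule norm_block_orthogonal)

lemma gram_orthogonal: "G \<in> block_orthogonal \<Longrightarrow> transpose G ** G = n *\<^sub>R mat 1"
  for G :: "('n, 'd) blockcol"
  unfolding n_def by (rule transpose_mult_self_block_orthogonal)

lemma inner_mat_1: "(mat 1 :: real ^ 'd ^ 'd) \<bullet> mat 1 = d"
  using norm_orthogonal_matrix[OF orthogonal_matrix_id, where 'd = 'd]
  unfolding norm_eq_sqrt_inner d_def by simp

lemma q_ge_1: "q \<ge> 1"
  unfolding q_def using n_ge_1 by (intro ge_one_powr_ge_zero) auto

text \<open>With the fourth root \<open>q\<close> of \<open>n\<close>, all fractional powers of
  \<open>n\<close> become natural powers and the estimates become polynomial.\<close>

lemma q_pow4: "q ^ 4 = n"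
proof -
  have "q powr real 4 = n"
    unfolding q_def using n_ge_1 by (subst powr_powr) simp
  then show ?thesis
    using q_ge_1 by (simp add: powr_realpow)
qed

lemma sqrt_n: "sqrt n = q\<^sup>2"
proof (rule real_sqrt_unique)
  show "(q\<^sup>2)\<^sup>2 = n"
    using q_pow4 by simp
qed simp

lemma opnorm_le_q: "opnorm \<Delta> \<le> q ^ 3 / (20 * sqrt d)"
proof -
  have "n powr (3 / 4) = q powr real 3"
    unfolding q_def by (simp add: powr_powr)
  also have "\<dots> = q ^ 3"
    using q_ge_1 by (intro powr_realpow) simp
  finally show ?thesis using opnorm_le by simp
qed

lemma opnorm_le_q3: "opnorm \<Delta> \<le> q ^ 3 / 20"
proof -
  have "q ^ 3 / (20 * sqrt d) \<le> q ^ 3 / (20 * 1)"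
    using q_ge_1 d_ge_1 by (intro divide_left_mono mult_left_mono) auto
  then show ?thesis using opnorm_le_q by simp
qed

lemma q3_le: "q ^ 3 \<le> n" and q2_le: "q\<^sup>2 \<le> n"
  using power_increasing[of 3 4 q] power_increasing[of 2 4 q] q_ge_1 q_pow4 by simp_all

lemma opnorm_le_n: "opnorm \<Delta> \<le> n / 20"
  using opnorm_le_q3 q3_le by simp

section \<open>Distance of the maximizer from the signal\<close>

definition \<delta> :: real where "\<delta> = norm (Gh - Gs)"

lemma \<delta>_nonneg: "\<delta> \<ge> 0"
  by (simp add: \<delta>_def)

text \<open>The defect of the overlap \<open>transpose Gs ** Gh\<close> from \<open>n\<close> times
  the identity: positive semidefinite and of second order in \<delta>.\<close>

definition W :: "real ^ 'd ^ 'd" where "W = (1 / 2) *\<^sub>R (transpose (Gh - Gs) ** (Gh - Gs))"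

lemma overlap_eq: "transpose Gs ** Gh = n *\<^sub>R mat 1 - W"
  unfolding W_def n_def by (rule transpose_mult_diff_aligned(1)[OF Gh Gs procrustes(1)[OF Gh Gs aligned]])

lemma inner_W: "W \<bullet> Y = (1 / 2) * ((Gh - Gs) \<bullet> ((Gh - Gs) ** Y))"
proof -
  have "(Gh - Gs) \<bullet> ((Gh - Gs) ** Y) = (transpose (Gh - Gs) ** (Gh - Gs)) \<bullet> Y"
    by (rule inner_mult_left)
  then show ?thesis
    unfolding W_def by simp
qed

lemma norm_W_le: "norm W \<le> \<delta>\<^sup>2 / 2"
proof -
  have "norm W = norm (transpose (Gh - Gs) ** (Gh - Gs)) / 2"
    by (simp add: W_def)
  also have "\<dots> \<le> (norm (transpose (Gh - Gs)) * norm (Gh - Gs)) / 2"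
    by (intro divide_right_mono norm_matrix_mult_le) simp
  finally show ?thesis
    by (simp add: \<delta>_def power2_eq_square)
qed

lemma fbar_signal_plus_noise: "fbar C G = (norm (transpose Gs ** G))\<^sup>2 + G \<bullet> (\<Delta> ** G)"
proof -
  have "G \<bullet> (Gs ** (transpose Gs ** G)) = (norm (transpose Gs ** G))\<^sup>2"
    unfolding power2_norm_eq_inner by (rule inner_mult_left)
  then show ?thesis
    unfolding fbar_eq_inner C matrix_mult_simps(1) inner_add_right
    by (simp only: matrix_mul_assoc)
qed

text \<open>Expanding the square of \<open>n *\<^sub>R mat 1 - W\<close> gives the linear loss
  \<open>2 * n\<close> times the trace of \<open>W\<close>, which is half of \<delta> squared.
  Positivity of the overlap bounds \<open>W \<bullet> W\<close> by \<open>n\<close> times that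
  trace, so half of the loss survives.\<close>

lemma norm_overlap_sq_le: "(norm (transpose Gs ** Gh))\<^sup>2 \<le> n\<^sup>2 * d - n * (\<delta>\<^sup>2 / 2)"
proof -
  have W1: "W \<bullet> mat 1 = \<delta>\<^sup>2 / 2"
    unfolding inner_W \<delta>_def power2_norm_eq_inner by simp
  have "0 \<le> (Gh - Gs) \<bullet> ((Gh - Gs) ** (transpose Gs ** Gh))"
    using norm_row_mult_quadratic_ge[of 0 "transpose Gs ** Gh" "Gh - Gs"]
      procrustes(2)[OF Gh Gs aligned] by simp
  then have "0 \<le> W \<bullet> (n *\<^sub>R mat 1 - W)"
    unfolding inner_W overlap_eq by simp
  then have WW: "W \<bullet> W \<le> n * (\<delta>\<^sup>2 / 2)"
    using W1 by (simp add: inner_diff_right)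
  have "(norm (transpose Gs ** Gh))\<^sup>2 = n * (n * (mat 1 \<bullet> (mat 1 :: real ^ 'd ^ 'd))) - 2 * n * (W \<bullet> mat 1) + W \<bullet> W"
    unfolding overlap_eq power2_norm_eq_inner
    by (simp add: inner_diff_left inner_diff_right inner_commute[of "mat 1" W] right_diff_distrib)
  also have "\<dots> = n\<^sup>2 * d - 2 * (n * (\<delta>\<^sup>2 / 2)) + W \<bullet> W"
    unfolding W1 inner_mat_1 power2_eq_square[of n] by simp
  finally show ?thesis
    using WW by linarith
qed

text \<open>Passing from \<open>Gs\<close> to the maximizer costs the signal at least
  \<open>n / 2\<close> times \<delta> squared, while the noise gains at most
  \<open>n * q / 10\<close> times \<delta>. The factor \<open>sqrt d\<close> in the noise bound
  cancels that of the norms of \<open>Gh\<close> and \<open>Gs\<close>.\<close>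

lemma \<delta>_le: "\<delta> \<le> q / 5"
proof -
  have "(norm (transpose Gs ** Gs))\<^sup>2 = n\<^sup>2 * d"
    unfolding gram_orthogonal[OF Gs] norm_scaleR power_mult_distrib power2_abs
      power2_norm_eq_inner[of "mat 1"] inner_mat_1 ..
  with opt[OF Gs] norm_overlap_sq_le
  have 1: "n * (\<delta>\<^sup>2 / 2) \<le> Gh \<bullet> (\<Delta> ** Gh) - Gs \<bullet> (\<Delta> ** Gs)"
    unfolding fbar_signal_plus_noise by simp
  have "Gs \<bullet> (\<Delta> ** Gh) = Gh \<bullet> (\<Delta> ** Gs)"
    by (metis inner_commute inner_mult_left sym)
  \<comment> \<open>Symmetry of the noise factors the difference of the two quadratic forms, which
    brings out one factor \<delta>.\<close>
  then have "Gh \<bullet> (\<Delta> ** Gh) - Gs \<bullet> (\<Delta> ** Gs) = (Gh - Gs) \<bullet> (\<Delta> ** (Gh + Gs))"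
    unfolding matrix_mult_simps(2) inner_diff_left inner_add_right by simp
  also have "\<dots> \<le> norm (Gh - Gs) * norm (\<Delta> ** (Gh + Gs))"
    by (rule norm_cauchy_schwarz)
  also have "\<dots> \<le> \<delta> * (q ^ 3 / (20 * sqrt d) * (2 * (q\<^sup>2 * sqrt d)))"
  proof -
    have nG: "norm G = q\<^sup>2 * sqrt d" if "G \<in> block_orthogonal" for G :: "('n, 'd) blockcol"
      using real_sqrt_unique[OF norm_sq_orthogonal[OF that] norm_ge_zero]
      by (simp add: real_sqrt_mult sqrt_n)
    have "norm (\<Delta> ** (Gh + Gs)) \<le> opnorm \<Delta> * norm (Gh + Gs)"
      by (rule norm_matrix_mult_opnorm_le)
    also have "\<dots> \<le> q ^ 3 / (20 * sqrt d) * (2 * (q\<^sup>2 * sqrt d))"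
    proof (intro mult_mono opnorm_le_q norm_ge_zero)
      show "norm (Gh + Gs) \<le> 2 * (q\<^sup>2 * sqrt d)"
        using norm_triangle_ineq[of Gh Gs] unfolding nG[OF Gh] nG[OF Gs] by linarith
      show "0 \<le> q ^ 3 / (20 * sqrt d)"
        using q_ge_1 d_ge_1 by (intro divide_nonneg_nonneg) auto
    qed
    finally show ?thesis
      unfolding \<delta>_def by (intro mult_left_mono norm_ge_zero)
  qed
  also have "\<dots> = \<delta> * (n * q / 10)"
    unfolding q_pow4[symmetric] using d_ge_1 by (simp add: field_simps flip: power_add power_Suc)
  finally have "n * \<delta> * \<delta> \<le> n * \<delta> * (q / 5)"
    using 1 by (simp add: power2_eq_square field_simps)
  then show ?thesis
    using n_ge_1 q_ge_1 \<delta>_nonneg by (cases "\<delta> = 0") (auto simp: mult_le_cancel_left)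
qed

section \<open>Lagrange multipliers of the orthogonality constraints at the maximizer\<close>

definition S :: "'n \<Rightarrow> real ^ 'd ^ 'd" where
  "S i = transpose (block Gh i) ** (block C i ** Gh)"

lemma block_mult_S: "block Gh i ** S i = block C i ** Gh"
  using block_orthogonalD[OF Gh, of i]
  by (simp add: S_def matrix_mul_assoc orthogonal_matrix_def)

text \<open>Only block \<open>i\<close> of the maximizer is rotated. The linear term of the
  objective is then twice the pairing with \<open>S i\<close>, and the quadratic term loses at most
  \<open>opnorm \<Delta>\<close> times the squared displacement.\<close>

lemma S_locally_optimal:
  assumes R: "orthogonal_matrix R"
  shows "S i \<bullet> (R - mat 1) \<le> opnorm \<Delta> / 2 * (norm (R - mat 1))\<^sup>2"
proof -
  define X where "X = stack (\<lambda>j. if j = i then block Gh i ** R else block Gh j)"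
  define D where "D = X - Gh"
  have X: "X \<in> block_orthogonal"
    using block_orthogonalD[OF Gh] R
    by (auto simp: X_def block_orthogonal_def orthogonal_matrix_mul)
  have D: "block D j = (if j = i then block Gh i ** (R - mat 1) else 0)" for j
    by (simp add: D_def X_def matrix_mult_simps)
  have "fbar C X = fbar C Gh + 2 * ((C ** Gh) \<bullet> D) + D \<bullet> (C ** D)"
    using fbar_add[OF transpose_signal_plus_noise[OF C sym], of Gh D] by (simp add: D_def)
  with opt[OF X] inner_signal_plus_noise_ge[OF C, of D]
  have "2 * ((C ** Gh) \<bullet> D) \<le> opnorm \<Delta> * (norm D)\<^sup>2"
    by simp
  moreover have "(C ** Gh) \<bullet> D = S i \<bullet> (R - mat 1)"
  proof -
    have "(C ** Gh) \<bullet> D = (\<Sum>j\<in>UNIV. if j = i then block (C ** Gh) i \<bullet> (block Gh i ** (R - mat 1)) else 0)"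
      unfolding inner_blocks D by (intro sum.cong) auto
    then show ?thesis
      unfolding S_def block_mult[symmetric] inner_mult_left[symmetric] by simp
  qed
  moreover have "(norm D)\<^sup>2 = (norm (R - mat 1))\<^sup>2"
  proof -
    have "(norm D)\<^sup>2 = (\<Sum>j\<in>UNIV. if j = i then (norm (block Gh i ** (R - mat 1)))\<^sup>2 else 0)"
      unfolding norm_sq_blocks D by (intro sum.cong) auto
    then show ?thesis
      by (simp add: norm_orthogonal_mult_left block_orthogonalD[OF Gh])
  qed
  ultimately show ?thesis by simp
qed

lemma transpose_S: "transpose (S i) = S i"
  by (rule symmetric_if_locally_optimal[OF S_locally_optimal])

text \<open>Three errors add up to 0.08: \<open>n / 20\<close> from the noise on \<open>Gs\<close>,
  \<open>q ^ 3 / 20 * (q / 5) = n / 100\<close> from the noise on \<open>Gh - Gs\<close>, and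
  \<open>n / 50\<close> from the overlap defect \<open>W\<close>.\<close>

lemma block_C_near: "norm (block C i ** Gh - n *\<^sub>R block Gs i) \<le> 8 / 100 * n"
proof -
  have 1: "block C i ** Gh - n *\<^sub>R block Gs i =
      block (\<Delta> ** Gs) i + block (\<Delta> ** (Gh - Gs)) i - block Gs i ** W"
    unfolding block_signal_mult[OF C] overlap_eq by (simp add: matrix_mult_simps)
  have "norm (block Gs i ** W) \<le> \<delta>\<^sup>2 / 2"
    using norm_W_le by (simp add: norm_orthogonal_mult_left block_orthogonalD[OF Gs])
  also have "\<delta>\<^sup>2 / 2 \<le> (q / 5)\<^sup>2 / 2"
    by (intro divide_right_mono power_mono \<delta>_le) (auto simp: \<delta>_def)
  also have "\<dots> \<le> n / 50"
    using q2_le by (simp add: power_divide)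
  finally have 2: "norm (block Gs i ** W) \<le> n / 50" .
  have 3: "norm (block (\<Delta> ** Gs) i) \<le> n / 20"
    using norm_block_le_norm_inf[of "\<Delta> ** Gs" i] noise_le by simp
  have "norm (block (\<Delta> ** (Gh - Gs)) i) \<le> norm (\<Delta> ** (Gh - Gs))"
    by (rule norm_block_le)
  also have "\<dots> \<le> opnorm \<Delta> * \<delta>"
    unfolding \<delta>_def by (rule norm_matrix_mult_opnorm_le)
  also have "\<dots> \<le> q ^ 3 / 20 * (q / 5)"
    using q_ge_1 by (intro mult_mono opnorm_le_q3 \<delta>_le) (auto simp: \<delta>_def)
  also have "\<dots> = n / 100"
    unfolding q_pow4[symmetric] by (simp add: power_eq_if)
  finally have "norm (block (\<Delta> ** (Gh - Gs)) i) \<le> n / 100" .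
  with 2 3 have "norm (block (\<Delta> ** Gs) i) + norm (block (\<Delta> ** (Gh - Gs)) i) + norm (block Gs i ** W) \<le> 8 / 100 * n"
    by linarith
  then show ?thesis
    unfolding 1
    using norm_triangle_ineq4[of "block (\<Delta> ** Gs) i + block (\<Delta> ** (Gh - Gs)) i" "block Gs i ** W"]
      norm_triangle_ineq[of "block (\<Delta> ** Gs) i" "block (\<Delta> ** (Gh - Gs)) i"]
    by linarith
qed

text \<open>Up to an orthogonal factor \<open>S i\<close> is a block of \<open>C ** Gh\<close>, and
  that is \<open>n\<close> times an isometry with error \<open>0.08 n\<close>.\<close>

lemma norm_S_bounds: "92 / 100 * n * norm v \<le> norm (S i *v v)" "norm (S i *v v) \<le> 108 / 100 * n * norm v"
proof -
  let ?Z = "block C i ** Gh - n *\<^sub>R block Gs i"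
  have "norm (?Z *v v) \<le> 8 / 100 * n * norm v"
    by (rule order_trans[OF norm_matrix_vector_le]) (intro mult_right_mono block_C_near norm_ge_zero)
  moreover have "norm (S i *v v) = norm ((block Gh i ** S i) *v v)"
    by (simp add: norm_orthogonal_matrix_vector block_orthogonalD[OF Gh] flip: matrix_vector_mul_assoc)
  moreover have "(block Gh i ** S i) *v v = n *\<^sub>R (block Gs i *v v) + ?Z *v v"
    unfolding block_mult_S
    by (simp add: matrix_vector_mult_diff_rdistrib scaleR_matrix_vector_assoc)
  moreover have "norm (n *\<^sub>R (block Gs i *v v)) = n * norm v"
    using n_ge_1 by (simp add: norm_orthogonal_matrix_vector block_orthogonalD[OF Gs])
  ultimately show "92 / 100 * n * norm v \<le> norm (S i *v v)" "norm (S i *v v) \<le> 108 / 100 * n * norm v"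
    using norm_triangle_ineq[of "n *\<^sub>R (block Gs i *v v)" "?Z *v v"]
      norm_diff_ineq[of "n *\<^sub>R (block Gs i *v v)" "?Z *v v"]
    by simp_all
qed

text \<open>The norm bounds alone leave the signs of the eigenvalues open; the reflection bound
  \<open>- n / 20\<close> excludes the negative ones. Numerically
  \<open>0.87^2 / 1.13 - 0.05\<close> exceeds 0.6.\<close>

lemma quadratic_form_S_ge: "v \<bullet> (S i *v v) \<ge> 6 / 10 * n * (norm v)\<^sup>2"
proof -
  have psd: "w \<bullet> (S i *v w) \<ge> - (n / 20) * (norm w)\<^sup>2" for w
  proof -
    have "- (n / 20) * (norm w)\<^sup>2 \<le> - 2 * (opnorm \<Delta> / 2) * (norm w)\<^sup>2"
      using opnorm_le_n by (intro mult_right_mono) auto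
    then show ?thesis
      using quadratic_form_ge_if_locally_optimal[where v = w and A = "S i" and c = "opnorm \<Delta> / 2",
          OF S_locally_optimal] by simp
  qed
  have "((92 / 100 * n - n / 20)\<^sup>2 / (108 / 100 * n + n / 20) - n / 20) * (norm v)\<^sup>2 \<le> v \<bullet> (S i *v v)"
    using n_ge_1 by (intro quadratic_form_ge_of_gap transpose_S norm_S_bounds psd) auto
  moreover have "(92 / 100 * n - n / 20)\<^sup>2 / (108 / 100 * n + n / 20) = 7569 / 11300 * n"
    using n_ge_1 by (simp add: power2_eq_square field_simps)
  ultimately have "(7569 / 11300 * n - n / 20) * (norm v)\<^sup>2 \<le> v \<bullet> (S i *v v)"
    by (simp only:)
  moreover have "6 / 10 * n * (norm v)\<^sup>2 \<le> (7569 / 11300 * n - n / 20) * (norm v)\<^sup>2"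
    using n_ge_1 by (intro mult_right_mono) auto
  ultimately show ?thesis by linarith
qed

section \<open>Upper bound on the gap and lower bound on the gradient\<close>

lemma norm_inner_S_mult_le: "\<bar>S i \<bullet> (K ** transpose K)\<bar> \<le> 108 / 100 * n * (norm K)\<^sup>2"
proof -
  have "\<bar>S i \<bullet> (K ** transpose K)\<bar> = \<bar>(S i ** K) \<bullet> K\<bar>"
    unfolding inner_mult_right transpose_transpose ..
  also have "\<dots> \<le> norm (S i ** K) * norm K"
    by (rule Cauchy_Schwarz_ineq2)
  also have "\<dots> \<le> (108 / 100 * n * norm K) * norm K"
    using n_ge_1 by (intro mult_right_mono norm_matrix_mult_le_by norm_S_bounds) auto
  finally show ?thesis
    by (simp only: power2_eq_square mult.assoc)
qed

text \<open>At the maximizer even the linear term is of second order in \<open>D\<close>. Twice its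
  bound \<open>0.54 n\<close> plus \<open>0.05 n\<close> from the quadratic term gives the constant
  1.13.\<close>

lemma fbar_gap_le:
  assumes H: "H \<in> block_orthogonal"
  shows "fbar C Gh - fbar C H \<le> 113 / 100 * n * (norm (H - Gh))\<^sup>2"
proof -
  define D where "D = H - Gh"
  have "(C ** Gh) \<bullet> D \<ge> (\<Sum>i\<in>UNIV. - (54 / 100 * n) * (norm (block D i))\<^sup>2)"
    unfolding inner_blocks[of "C ** Gh"]
  proof (rule sum_mono)
    fix i :: 'n
    define R where "R = transpose (block Gh i) ** block H i"
    define K where "K = R - mat 1"
    have R: "orthogonal_matrix R"
      unfolding R_def using block_orthogonalD[OF Gh] block_orthogonalD[OF H]
      by (intro orthogonal_matrix_mul) auto
    have D: "block D i = block Gh i ** K"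
      using block_orthogonalD[OF Gh, of i]
      by (simp add: D_def K_def R_def matrix_mult_simps matrix_mul_assoc orthogonal_matrix_def)
    \<comment> \<open>Orthogonality of \<open>mat 1 + K\<close> makes the symmetric part of
      \<open>K\<close> quadratic, and the symmetric \<open>S i\<close> pairs only with that
      part.\<close>
    have KK: "K + transpose K = - (K ** transpose K)"
      using R by (simp add: K_def transpose_linear_simps matrix_mult_simps orthogonal_matrix_def)
    have "block (C ** Gh) i \<bullet> block D i = S i \<bullet> K"
      unfolding D inner_mult_left S_def block_mult ..
    also have "\<dots> = (S i \<bullet> (K + transpose K)) / 2"
      using inner_transpose[of "S i" K] by (simp add: transpose_S inner_add_right)
    also have "\<dots> = - (S i \<bullet> (K ** transpose K)) / 2"
      unfolding KK by simp
    finally show "- (54 / 100 * n) * (norm (block D i))\<^sup>2 \<le> block (C ** Gh) i \<bullet> block D i"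
      using norm_inner_S_mult_le[of i K]
      unfolding D norm_orthogonal_mult_left[OF block_orthogonalD[OF Gh]] by linarith
  qed
  then have "(C ** Gh) \<bullet> D \<ge> - (54 / 100 * n) * (norm D)\<^sup>2"
    unfolding norm_sq_blocks[of D] sum_distrib_left .
  moreover have "fbar C H = fbar C Gh + 2 * ((C ** Gh) \<bullet> D) + D \<bullet> (C ** D)"
    using fbar_add[OF transpose_signal_plus_noise[OF C sym], of Gh D] by (simp add: D_def)
  moreover have "D \<bullet> (C ** D) \<ge> - opnorm \<Delta> * (norm D)\<^sup>2"
    by (rule inner_signal_plus_noise_ge[OF C])
  moreover have "opnorm \<Delta> * (norm D)\<^sup>2 \<le> n / 20 * (norm D)\<^sup>2"
    by (intro mult_right_mono opnorm_le_n) simp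
  ultimately show ?thesis
    unfolding D_def[symmetric] by linarith
qed

text \<open>\<open>Gs\<close> is compared with \<open>Gh\<close>: the overlap of \<open>Gh\<close>
  with the difference is of second order by alignment, and the remainder carries a factor \<delta>.
  After multiplication by \<open>Gs\<close>, of gain \<open>sqrt n\<close>, these give 0.05 and 0.2;
  the noise adds 0.05.\<close>

lemma norm_C_mult_diff_le:
  assumes H: "H \<in> block_orthogonal"
    and H_sym: "transpose (transpose Gh ** H) = transpose Gh ** H"
    and H_near: "norm (H - Gh) \<le> sqrt n / 10"
  shows "norm (C ** (H - Gh)) \<le> 3 / 10 * n * norm (H - Gh)"
proof -
  define D where "D = H - Gh"
  have "norm (transpose Gh ** D) = norm (transpose D ** D) / 2"
    unfolding D_def transpose_mult_diff_aligned(2)[OF H Gh H_sym] by simp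
  also have "\<dots> \<le> (norm (transpose D) * norm D) / 2"
    by (intro divide_right_mono norm_matrix_mult_le) simp
  also have "\<dots> \<le> (q\<^sup>2 / 10 * norm D) / 2"
    using H_near unfolding D_def sqrt_n by (intro divide_right_mono mult_right_mono) auto
  finally have 1: "norm (transpose Gh ** D) \<le> q\<^sup>2 / 20 * norm D"
    by simp
  have 2: "norm (transpose (Gh - Gs) ** D) \<le> q / 5 * norm D"
  proof -
    have "norm (transpose (Gh - Gs) ** D) \<le> \<delta> * norm D"
      using norm_matrix_mult_le[of "transpose (Gh - Gs)" D] unfolding \<delta>_def by simp
    also have "\<dots> \<le> q / 5 * norm D"
      by (intro mult_right_mono \<delta>_le norm_ge_zero)
    finally show ?thesis .
  qed
  have "transpose Gs ** D = transpose Gh ** D - transpose (Gh - Gs) ** D"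
    by (simp add: transpose_linear_simps matrix_mult_simps)
  then have "norm (transpose Gs ** D) \<le> q\<^sup>2 / 20 * norm D + q / 5 * norm D"
    using norm_triangle_ineq4[of "transpose Gh ** D" "transpose (Gh - Gs) ** D"] 1 2 by simp
  then have "q\<^sup>2 * norm (transpose Gs ** D) \<le> q\<^sup>2 * (q\<^sup>2 / 20 * norm D + q / 5 * norm D)"
    by (intro mult_left_mono) auto
  also have "\<dots> = (n / 20 + q ^ 3 / 5) * norm D"
    unfolding q_pow4[symmetric] by (simp add: power_eq_if algebra_simps)
  also have "\<dots> \<le> (n / 20 + n / 5) * norm D"
    using q3_le by (intro mult_right_mono) auto
  finally have "norm (Gs ** (transpose Gs ** D)) \<le> (n / 20 + n / 5) * norm D"
    using norm_block_orthogonal_mult[OF Gs, of "transpose Gs ** D"] by (simp add: sqrt_n flip: n_def)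
  moreover have "norm (\<Delta> ** D) \<le> n / 20 * norm D"
    by (rule order_trans[OF norm_matrix_mult_opnorm_le]) (intro mult_right_mono opnorm_le_n norm_ge_zero)
  moreover have "C ** D = Gs ** (transpose Gs ** D) + \<Delta> ** D"
    unfolding C matrix_mult_simps(1) matrix_mul_assoc ..
  ultimately show ?thesis
    using norm_triangle_ineq[of "Gs ** (transpose Gs ** D)" "\<Delta> ** D"]
    unfolding D_def[symmetric] by (simp add: algebra_simps)
qed

text \<open>Pairing with \<open>transpose R - R\<close> and cancelling its norm yields the factor
  0.6; the radius \<open>1 / 4\<close> leaves \<open>2 - 1 / 4 = 7 / 4\<close> in the comparison
  with \<open>R - mat 1\<close>, and \<open>0.6 * 7 / 4 = 1.05\<close>.\<close>

lemma norm_commutator_S_ge: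
  assumes R: "orthogonal_matrix R" and R_near: "norm (R - mat 1) \<le> 1 / 4"
  shows "norm (transpose R ** S i - S i ** R) \<ge> 105 / 100 * n * norm (R - mat 1)"
proof -
  define X where "X = transpose R - R"
  define M where "M = transpose R ** S i - S i ** R"
  have "6 / 10 * n * (norm X)\<^sup>2 \<le> X \<bullet> (X ** S i)"
    by (rule norm_row_mult_quadratic_ge[OF quadratic_form_S_ge])
  also have "\<dots> = M \<bullet> X"
    unfolding M_def X_def by (rule inner_commutator_orthogonal[OF R transpose_S, symmetric])
  also have "\<dots> \<le> norm M * norm X"
    by (rule norm_cauchy_schwarz)
  finally have "(6 / 10 * n * norm X) * norm X \<le> norm M * norm X"
    by (simp only: power2_eq_square mult.assoc)
  then have MX: "6 / 10 * n * norm X \<le> norm M"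
    by (cases "norm X = 0") (simp_all add: mult_le_cancel_right)
  have "7 / 4 * norm (R - mat 1) \<le> (2 - norm (R - mat 1)) * norm (R - mat 1)"
    using R_near by (intro mult_right_mono) auto
  also have "\<dots> \<le> norm X"
    unfolding X_def by (rule norm_orthogonal_diff_transpose_ge[OF R])
  finally have "6 / 10 * n * (7 / 4 * norm (R - mat 1)) \<le> 6 / 10 * n * norm X"
    using n_ge_1 by (intro mult_left_mono) auto
  with MX show ?thesis
    unfolding M_def by simp
qed

text \<open>\<open>U\<close> is the gradient with \<open>C ** H\<close> replaced by
  \<open>C ** Gh\<close>, and \<open>V\<close> is the correction from \<open>C ** D\<close>. The
  constants combine to \<open>1.05 - 2 * 0.3 = 0.45\<close>.\<close>

lemma error_bound:
  assumes H: "H \<in> block_orthogonal"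
    and H_sym: "transpose (transpose Gh ** H) = transpose Gh ** H"
    and H_near: "norm (H - Gh) \<le> sqrt n / 10"
    and H_near_inf: "norm_inf (H - Gh) \<le> 1 / 4"
  shows "norm (rgrad C H) \<ge> 45 / 100 * n * norm (H - Gh)"
proof -
  define D where "D = H - Gh"
  define R where "R i = transpose (block Gh i) ** block H i" for i
  define B where "B i = transpose (block H i) ** block (C ** D) i" for i
  define U where "U = stack (\<lambda>i. block H i ** (transpose (R i) ** S i - S i ** R i))"
  define V where "V = stack (\<lambda>i. block H i ** (B i - transpose (B i)))"
  have R: "orthogonal_matrix (R i)" for i
    unfolding R_def using block_orthogonalD[OF Gh] block_orthogonalD[OF H]
    by (intro orthogonal_matrix_mul) auto
  have D: "block D i = block Gh i ** (R i - mat 1)" for i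
    using block_orthogonalD[OF Gh, of i]
    by (simp add: D_def R_def matrix_mult_simps matrix_mul_assoc orthogonal_matrix_def)
  have "rgrad C H = U + V"
    unfolding block_eq_iff
  proof
    fix i
    have "block C i ** H = block Gh i ** S i + block (C ** D) i"
      by (simp add: block_mult_S D_def matrix_mult_simps)
    then have "transpose (block H i) ** (block C i ** H) = transpose (R i) ** S i + B i"
      unfolding B_def R_def by (simp add: matrix_mult_simps matrix_transpose_mul matrix_mul_assoc)
    then show "block (rgrad C H) i = block (U + V) i"
      unfolding block_rgrad[OF H] skew_grad_def U_def V_def
      by (simp add: transpose_linear_simps matrix_transpose_mul transpose_S matrix_mult_simps)
  qed
  moreover have "norm D * (105 / 100 * n) \<le> norm U"
  proof -
    \<comment> \<open>The blockwise lower bound on \<open>U\<close> is inverted, since blocks are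
      summed through an upper bound.\<close>
    have "norm D \<le> 1 / (105 / 100 * n) * norm U"
    proof (rule norm_le_by_blocks)
      fix i
      have "norm (R i - mat 1) = norm (block D i)"
        by (simp add: D norm_orthogonal_mult_left block_orthogonalD[OF Gh])
      moreover have "norm (block D i) \<le> 1 / 4"
        using H_near_inf unfolding norm_inf_le D_def by blast
      ultimately have "105 / 100 * n * norm (block D i) \<le> norm (block U i)"
        using norm_commutator_S_ge[OF R, of i i]
        by (simp add: U_def norm_orthogonal_mult_left block_orthogonalD[OF H])
      then show "norm (block D i) \<le> 1 / (105 / 100 * n) * norm (block U i)"
        using n_ge_1 by (simp add: field_simps)
    qed (use n_ge_1 in simp)
    then show ?thesis
      using n_ge_1 by (simp add: field_simps)
  qed
  moreover have "norm V \<le> 2 * norm (C ** D)"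
  proof (rule norm_le_by_blocks)
    fix i
    have "norm (block V i) \<le> norm (B i) + norm (transpose (B i))"
      unfolding V_def block_stack norm_orthogonal_mult_left[OF block_orthogonalD[OF H]]
      by (rule norm_triangle_ineq4)
    then show "norm (block V i) \<le> 2 * norm (block (C ** D) i)"
      unfolding B_def norm_transpose
      by (simp add: norm_orthogonal_mult_left block_orthogonalD[OF H])
  qed simp
  moreover have "norm (C ** D) \<le> 3 / 10 * n * norm D"
    unfolding D_def by (rule norm_C_mult_diff_le[OF H H_sym H_near])
  ultimately show ?thesis
    using norm_diff_ineq[of U V] unfolding D_def[symmetric] by (simp add: algebra_simps)
qed

text \<open>The distance is eliminated between the gap bound and the error bound; 6 suffices because
  \<open>6 * 0.45^2 = 1.215\<close> is at least 1.13.\<close>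

lemma fbar_gap_le_rgrad:
  assumes "H \<in> block_orthogonal" "transpose (transpose Gh ** H) = transpose Gh ** H"
    "norm (H - Gh) \<le> sqrt n / 10" "norm_inf (H - Gh) \<le> 1 / 4"
  shows "fbar C Gh - fbar C H \<le> 6 / n * (norm (rgrad C H))\<^sup>2"
proof -
  have "(45 / 100 * n * norm (H - Gh))\<^sup>2 \<le> (norm (rgrad C H))\<^sup>2"
    using error_bound[OF assms] n_ge_1 by (intro power_mono) auto
  then have "6 / n * (45 / 100 * n * norm (H - Gh))\<^sup>2 \<le> 6 / n * (norm (rgrad C H))\<^sup>2"
    using n_ge_1 by (intro mult_left_mono) auto
  moreover have "6 / n * (45 / 100 * n * norm (H - Gh))\<^sup>2 = 6 * (45 / 100)\<^sup>2 * n * (norm (H - Gh))\<^sup>2"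
    unfolding power_mult_distrib power2_eq_square[of n] using n_ge_1 by simp
  moreover have "113 / 100 * n * (norm (H - Gh))\<^sup>2 \<le> 6 * (45 / 100)\<^sup>2 * n * (norm (H - Gh))\<^sup>2"
    using n_ge_1 by (intro mult_right_mono) (auto simp: power2_eq_square)
  ultimately show ?thesis
    using fbar_gap_le[OF assms(1)] by linarith
qed

end

section \<open>Linear convergence\<close>

text \<open>A decrease of square roots telescopes. The drop \<open>e - e'\<close> factors into the
  difference and the sum of the roots; gradient domination bounds the sum by
  \<open>2 * sqrt K * g\<close>, and one \<open>g\<close> cancels.\<close>

lemma sqrt_descent_le:
  fixes c K t g e e' :: real
  assumes pos: "c > 0" "K > 0" "t \<ge> 0" "g \<ge> 0" "e' \<ge> 0"
    and descent: "c * (t * g\<^sup>2) \<le> e - e'" and PL: "e \<le> K * g\<^sup>2"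
  shows "t * g \<le> 2 * sqrt K / c * (sqrt e - sqrt e')"
proof -
  have "0 \<le> c * (t * g\<^sup>2)"
    using pos by simp
  with descent have le: "e' \<le> e" by linarith
  have e: "sqrt e \<le> sqrt K * g"
    using real_sqrt_le_mono[OF PL] pos by (simp add: real_sqrt_mult)
  have "c * (t * g\<^sup>2) \<le> (sqrt e)\<^sup>2 - (sqrt e')\<^sup>2"
    using descent le pos by simp
  also have "\<dots> = (sqrt e - sqrt e') * (sqrt e + sqrt e')"
    by (simp add: power2_eq_square algebra_simps)
  also have "\<dots> \<le> (sqrt e - sqrt e') * (2 * (sqrt K * g))"
    using e le real_sqrt_le_mono[OF le] by (intro mult_left_mono) linarith+
  finally have "(c * (t * g)) * g \<le> (2 * sqrt K * (sqrt e - sqrt e')) * g"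
    by (simp add: power2_eq_square mult_ac)
  then have "c * (t * g) \<le> 2 * sqrt K * (sqrt e - sqrt e')"
    using pos le by (cases "g = 0") (auto simp: mult_le_cancel_right)
  then show ?thesis
    using pos by (simp add: field_simps)
qed

text \<open>Descent and gradient domination contract \<open>e\<close> by
  \<open>1 - c * tmin / K\<close>. That number may be nonpositive for large \<open>tmin\<close>, so
  \<open>lam\<close> is any rate in the unit interval above it. The limit of \<open>g\<close> later
  identifies the limit of \<open>x\<close>.\<close>

lemma linear_convergence_of_gradient_domination:
  fixes x :: "nat \<Rightarrow> 'a::banach" and e g t :: "nat \<Rightarrow> real"
  assumes pos: "c > 0" "K > 0" "tmin > 0" and nonneg: "\<And>k. e k \<ge> 0" "\<And>k. g k \<ge> 0"
    and tmin: "\<And>k. tmin \<le> t k"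
    and descent: "\<And>k. c * (t k * (g k)\<^sup>2) \<le> e k - e (Suc k)"
    and PL: "\<And>k. e k \<le> K * (g k)\<^sup>2"
    and step: "\<And>k. norm (x (Suc k) - x k) \<le> t k * g k"
    and lam: "0 < lam" "lam < 1" "1 - c * tmin / K \<le> lam"
  shows "e k \<le> e 0 * lam ^ k" and "g \<longlonglongrightarrow> 0"
    and "\<exists>L. x \<longlonglongrightarrow> L \<and> (\<forall>k. norm (x k - L) \<le> 2 * sqrt K / c * sqrt (e 0) * lam powr (real k / 2))"
proof -
  define a where "a = 2 * sqrt K / c"
  have a: "a > 0" using pos by (simp add: a_def)
  have gap: "c * tmin * (g k)\<^sup>2 \<le> e k - e (Suc k)" for k
  proof -
    have "c * tmin * (g k)\<^sup>2 \<le> c * (t k * (g k)\<^sup>2)"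
      unfolding mult.assoc using pos tmin by (intro mult_left_mono mult_right_mono) auto
    with descent[of k] show ?thesis by linarith
  qed
  have contract: "e (Suc k) \<le> lam * e k" for k
  proof -
    have "c * tmin / K * e k \<le> c * tmin / K * (K * (g k)\<^sup>2)"
      using pos by (intro mult_left_mono PL) auto
    also have "\<dots> = c * tmin * (g k)\<^sup>2"
      using pos by simp
    finally have "e (Suc k) \<le> (1 - c * tmin / K) * e k"
      using gap[of k] unfolding left_diff_distrib by linarith
    also have "\<dots> \<le> lam * e k"
      using nonneg by (intro mult_right_mono lam)
    finally show ?thesis .
  qed
  show decay: "e k \<le> e 0 * lam ^ k" for k
  proof (induction k)
    case (Suc k)
    have "e (Suc k) \<le> lam * (e 0 * lam ^ k)"
      by (rule order_trans[OF contract]) (use lam Suc in \<open>intro mult_left_mono, auto\<close>)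
    then show ?case by (simp add: mult_ac)
  qed simp
  have lim_pow: "(\<lambda>k. e 0 * lam ^ k) \<longlonglongrightarrow> 0"
    using lam by (intro tendsto_mult_right_zero LIMSEQ_realpow_zero) auto
  have "(\<lambda>k. (g k)\<^sup>2) \<longlonglongrightarrow> 0"
  proof (rule tendsto_sandwich[OF _ _ tendsto_const])
    show "(\<lambda>k. (e 0 * lam ^ k) / (c * tmin)) \<longlonglongrightarrow> 0"
      using tendsto_divide[OF lim_pow tendsto_const[of "c * tmin"]] pos by simp
    \<comment> \<open>As the next gap is nonnegative, the decrease in one step is at most the
      present gap.\<close>
    have "(g k)\<^sup>2 \<le> (e 0 * lam ^ k) / (c * tmin)" for k
      using gap[of k] nonneg(1)[of "Suc k"] decay[of k] pos by (simp add: le_divide_eq mult.commute)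
    then show "\<forall>\<^sub>F k in sequentially. (g k)\<^sup>2 \<le> (e 0 * lam ^ k) / (c * tmin)"
      by simp
  qed simp
  from tendsto_real_sqrt[OF this] show "g \<longlonglongrightarrow> 0"
    using nonneg by simp
  \<comment> \<open>The differences of square roots telescope, so the constant \<open>a\<close>
    involves neither \<open>tmin\<close> nor \<open>lam\<close>.\<close>
  have seg: "norm (x (k + m) - x k) \<le> a * (sqrt (e k) - sqrt (e (k + m)))" for k m
  proof (induction m)
    case (Suc m)
    have "norm (x (Suc (k + m)) - x (k + m)) \<le> a * (sqrt (e (k + m)) - sqrt (e (Suc (k + m))))"
      unfolding a_def
      by (rule order_trans[OF step sqrt_descent_le])
        (use pos nonneg tmin[of "k + m"] descent PL in auto)
    then show ?case
      using Suc norm_triangle_ineq[of "x (Suc (k + m)) - x (k + m)" "x (k + m) - x k"]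
      by (simp add: algebra_simps)
  qed simp
  have seg': "norm (x (k + m) - x k) \<le> a * sqrt (e k)" for k m
  proof -
    have "a * (sqrt (e k) - sqrt (e (k + m))) \<le> a * sqrt (e k)"
      using a nonneg by (intro mult_left_mono) auto
    with seg[of k m] show ?thesis by linarith
  qed
  have sqrt_lam: "sqrt (lam ^ k) = lam powr (real k / 2)" for k
    using lam by (simp add: powr_half_sqrt[symmetric] powr_powr flip: powr_realpow)
  have tail: "a * sqrt (e k) \<le> a * sqrt (e 0) * lam powr (real k / 2)" for k
  proof -
    have "sqrt (e k) \<le> sqrt (e 0) * sqrt (lam ^ k)"
      using real_sqrt_le_mono[OF decay[of k]] by (simp add: real_sqrt_mult)
    then show ?thesis
      using a unfolding sqrt_lam mult.assoc by (intro mult_left_mono) auto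
  qed
  have "(\<lambda>k. a * sqrt (e 0 * lam ^ k)) \<longlonglongrightarrow> a * sqrt 0"
    by (intro tendsto_intros lim_pow)
  then have "(\<lambda>k. a * sqrt (e 0 * lam ^ k)) \<longlonglongrightarrow> 0"
    by simp
  then have small: "\<exists>N. \<forall>k\<ge>N. a * sqrt (e 0 * lam ^ k) < \<epsilon>" if "\<epsilon> > 0" for \<epsilon>
    using that order_tendstoD(2)[of _ 0 sequentially \<epsilon>] unfolding eventually_sequentially by blast
  have "Cauchy x"
  proof (rule CauchyI')
    fix \<epsilon> :: real assume "\<epsilon> > 0"
    from small[OF this] obtain N where N: "\<And>k. k \<ge> N \<Longrightarrow> a * sqrt (e 0 * lam ^ k) < \<epsilon>"
      by blast
    show "\<exists>M. \<forall>m\<ge>M. \<forall>j>m. dist (x m) (x j) < \<epsilon>"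
    proof (intro exI allI impI)
      fix m j assume "m \<ge> N" "j > m"
      have "norm (x m - x j) \<le> a * sqrt (e m)"
        using seg'[of m "j - m"] \<open>j > m\<close> by (simp add: norm_minus_commute)
      also have "\<dots> \<le> a * sqrt (e 0 * lam ^ m)"
        using a decay by (intro mult_left_mono real_sqrt_le_mono) auto
      also have "\<dots> < \<epsilon>" by (rule N[OF \<open>m \<ge> N\<close>])
      finally show "dist (x m) (x j) < \<epsilon>"
        by (simp only: dist_norm)
    qed
  qed
  then obtain L where L: "x \<longlonglongrightarrow> L"
    using Cauchy_convergent_iff convergent_def by blast
  have "norm (x k - L) \<le> a * sqrt (e 0) * lam powr (real k / 2)" for k
  proof -
    have "(\<lambda>m. norm (x k - x (m + k))) \<longlonglongrightarrow> norm (x k - L)"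
      by (intro tendsto_intros LIMSEQ_ignore_initial_segment L)
    moreover have "norm (x k - x (m + k)) \<le> a * sqrt (e k)" for m
      using seg'[of k m] by (simp add: norm_minus_commute add.commute)
    ultimately have "norm (x k - L) \<le> a * sqrt (e k)"
      by (intro LIMSEQ_le_const2) auto
    with tail[of k] show ?thesis by linarith
  qed
  with L show "\<exists>L. x \<longlonglongrightarrow> L \<and> (\<forall>k. norm (x k - L) \<le> 2 * sqrt K / c * sqrt (e 0) * lam powr (real k / 2))"
    unfolding a_def by blast
qed

section \<open>Common rotations and the distance of classes\<close>

lemma block_orthogonal_mult:
  assumes "G \<in> block_orthogonal" "orthogonal_matrix Q"
  shows "G ** Q \<in> block_orthogonal"
  using assms by (simp add: block_orthogonal_def orthogonal_matrix_mul)

lemma fbar_mult_orthogonal: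
  assumes "orthogonal_matrix Q"
  shows "fbar C (G ** Q) = fbar C G"
proof -
  have "fbar C (G ** Q) = ((G ** Q) ** transpose Q) \<bullet> (C ** G)"
    unfolding fbar_eq_inner matrix_mul_assoc inner_mult_right ..
  then show ?thesis
    using assms by (simp add: fbar_eq_inner orthogonal_matrix_def flip: matrix_mul_assoc)
qed

lemma rgrad_mult_orthogonal:
  assumes Q: "orthogonal_matrix Q"
  shows "rgrad C (G ** Q) = rgrad C G ** Q"
  unfolding block_eq_iff
proof
  fix i
  have "block G i ** Q ** (transpose Q ** transpose (block C i ** G)) =
      block G i ** (Q ** transpose Q) ** transpose (block C i ** G)"
    by (simp only: matrix_mul_assoc)
  also have "\<dots> = block G i ** transpose (block C i ** G)"
    using Q by (simp add: orthogonal_matrix_def)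
  finally show "block (rgrad C (G ** Q)) i = block (rgrad C G ** Q) i"
    by (simp add: rgrad_def matrix_mul_assoc matrix_mult_simps)
      (simp add: matrix_transpose_mul flip: matrix_mul_assoc)
qed

lemma dF_le: "orthogonal_matrix R \<Longrightarrow> dF X Y \<le> norm (X - Y ** R)"
  using dF_attained[of X Y] by metis

text \<open>\<open>dF\<close> rotates its second argument, whereas the iterate is rotated here;
  right multiplication by \<open>Q\<close> passes from one form to the other.\<close>

lemma norm_diff_aligned_le:
  assumes Q: "orthogonal_matrix Q" and attained: "dF X Y = norm (X ** Q - Y)"
    and R: "orthogonal_matrix R"
  shows "norm (X ** Q - Y) \<le> norm (X ** Q - Y ** R)"
proof -
  have "dF X Y \<le> norm (X - Y ** (R ** transpose Q))"
    using Q R by (intro dF_le orthogonal_matrix_mul) auto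
  also have "\<dots> = norm ((X - Y ** (R ** transpose Q)) ** Q)"
    by (rule norm_orthogonal_mult_right[OF Q, symmetric])
  also have "(X - Y ** (R ** transpose Q)) ** Q = X ** Q - Y ** R"
    using Q by (simp add: matrix_mult_simps orthogonal_matrix_def flip: matrix_mul_assoc)
  finally show ?thesis unfolding attained .
qed

lemma mem_orbit_if_dF_zero:
  assumes "dF X Y = 0"
  shows "X \<in> orbit Y"
proof -
  obtain Q where "orthogonal_matrix Q" "dF X Y = norm (X - Y ** Q)"
    by (rule dF_attained)
  with assms show ?thesis
    by (auto simp: orbit_def)
qed

lemma dF_le_add_norm: "dF X Y \<le> norm (X - Z) + dF Z Y"
proof -
  obtain Q where Q: "orthogonal_matrix Q" "dF Z Y = norm (Z - Y ** Q)"
    by (rule dF_attained)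
  have "dF X Y \<le> norm ((X - Z) + (Z - Y ** Q))"
    using dF_le[OF Q(1), of X Y] by simp
  also have "\<dots> \<le> norm (X - Z) + dF Z Y"
    unfolding Q(2) by (rule norm_triangle_ineq)
  finally show ?thesis .
qed

lemma dF_nonneg: "0 \<le> dF X Y"
  by (rule dF_attained[of X Y]) simp

text \<open>\<open>n\<close> over an upper bound of the step size denominator, with
  \<open>opnorm \<Delta>\<close> replaced by \<open>n\<close> and
  \<open>norm_inf (\<Delta> ** G)\<close> by \<open>n * sqrt (n * d)\<close>.\<close>

definition ascent_const :: "real \<Rightarrow> real \<Rightarrow> real" where
  "ascent_const n d = n / (n * (d + 1) + n + sqrt d * (n * sqrt (n * d)))"

lemma ascent_const_pos: "ascent_const n d > 0" if "n \<ge> 1" "d \<ge> 1"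
  unfolding ascent_const_def using that
  by (intro divide_pos_pos add_pos_nonneg) auto

context aligned_optimum
begin

text \<open>The surplus \<open>n\<close> of \<open>n (d + 1)\<close> over \<open>n d\<close> in the step size bound keeps the ascent constant
  away from \<open>0\<close> even for \<open>\<alpha> \<rightarrow> 0\<close>, so the rate does not depend on \<open>\<alpha>\<close>.\<close>

lemma sufficient_ascent:
  assumes G: "G \<in> block_orthogonal" and t: "0 \<le> t"
    and t_le: "t \<le> 1 / (n * (d + 1) + opnorm \<Delta> + sqrt d * norm_inf (\<Delta> ** G))"
  shows "ascent_const n d * (t * (norm (rgrad C G))\<^sup>2) \<le> fbar C (Exp_map G (t *\<^sub>R rgrad C G)) - fbar C G"
proof -
  define m where "m = norm_inf (\<Delta> ** G)"
  define D where "D = n * (d + 1) + opnorm \<Delta> + sqrt d * m"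
  have m0: "m \<ge> 0" unfolding m_def by (rule norm_inf_nonneg)
  have "m \<le> norm (\<Delta> ** G)"
    unfolding m_def norm_inf_le using norm_block_le by blast
  also have "\<dots> \<le> opnorm \<Delta> * norm G"
    by (rule norm_matrix_mult_opnorm_le)
  also have "\<dots> \<le> n * sqrt (n * d)"
    using opnorm_le_n n_ge_1 real_sqrt_unique[OF norm_sq_orthogonal[OF G] norm_ge_zero]
    by (intro mult_mono) auto
  finally have m_le: "m \<le> n * sqrt (n * d)" .
  have m_le': "m \<le> sqrt d * m"
    using mult_right_mono[OF real_sqrt_ge_one[OF d_ge_1] m0] by simp
  have "0 \<le> n * d"
    using n_ge_1 d_ge_1 by simp
  then have D_pos: "D > 0"
    using n_ge_1 opnorm_nonneg[of \<Delta>] m0 m_le' unfolding D_def by (simp add: distrib_left)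
  have D_le: "D \<le> n * (d + 1) + n + sqrt d * (n * sqrt (n * d))"
    unfolding D_def using opnorm_le_n n_ge_1 d_ge_1 by (intro add_mono mult_left_mono m_le) auto
  have "ascent_const n d \<le> n / D"
    unfolding ascent_const_def using n_ge_1 D_pos D_le by (intro divide_left_mono mult_pos_pos) auto
  also have "\<dots> \<le> 1 - 1 / D * (n * d + opnorm \<Delta> + m)"
  proof -
    \<comment> \<open>\<open>D\<close> exceeds \<open>n * d + opnorm \<Delta> + m\<close> by at
      least \<open>n\<close>, because \<open>sqrt d * m\<close> is at least
      \<open>m\<close>.\<close>
    have "n / D \<le> (D - (n * d + opnorm \<Delta> + m)) / D"
      using D_pos m_le' by (intro divide_right_mono) (simp_all add: D_def distrib_left)
    then show ?thesis
      using D_pos by (simp add: diff_divide_distrib)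
  qed
  also have "\<dots> \<le> 1 - t * (n * d + opnorm \<Delta> + m)"
    using t_le m0 opnorm_nonneg[of \<Delta>] \<open>0 \<le> n * d\<close> unfolding D_def m_def
    by (intro diff_left_mono mult_right_mono) auto
  finally have "t * (norm (rgrad C G))\<^sup>2 * ascent_const n d
      \<le> t * (norm (rgrad C G))\<^sup>2 * (1 - t * (n * d + opnorm \<Delta> + m))"
    using t by (intro mult_left_mono) auto
  also have "\<dots> \<le> fbar C (Exp_map G (t *\<^sub>R rgrad C G)) - fbar C G"
    using ascent[OF G Gs C sym t] unfolding m_def n_def d_def .
  finally show ?thesis by (simp only: mult.commute)
qed

text \<open>Descent and step length concern \<open>G k\<close> itself, gradient domination its
  aligned representative \<open>G k ** Q k\<close>; invariance under rotation joins them.\<close>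

lemma gradient_method_converges:
  fixes G :: "nat \<Rightarrow> ('n, 'd) blockcol" and t :: "nat \<Rightarrow> real" and Q :: "nat \<Rightarrow> real ^ 'd ^ 'd"
  assumes G: "\<And>k. G k \<in> block_orthogonal"
    and iter: "\<And>k. G (Suc k) = Exp_map (G k) (t k *\<^sub>R rgrad C (G k))"
    and tmin: "tmin > 0" "\<And>k. tmin \<le> t k"
    and t_le: "\<And>k. t k \<le> 1 / (n * (d + 1) + opnorm \<Delta> + sqrt d * norm_inf (\<Delta> ** G k))"
    and Q: "\<And>k. orthogonal_matrix (Q k)" "\<And>k. dF (G k) Gh = norm (G k ** Q k - Gh)"
    and near: "\<And>k. dF (G k) Gh \<le> sqrt n / 10" "\<And>k. norm_inf (G k ** Q k - Gh) \<le> 1 / 4"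
    and lam: "0 < lam" "lam < 1" "1 - ascent_const n d * tmin / (6 / n) \<le> lam"
  shows "fbar C Gh - fbar C (G k) \<le> (fbar C Gh - fbar C (G 0)) * lam ^ k"
    and "\<exists>L\<in>orbit Gh. \<forall>k. dF (G k) Gh \<le> norm (G k - L) \<and>
      norm (G k - L) \<le> 2 * sqrt (6 / n) / ascent_const n d * sqrt (fbar C Gh - fbar C (G 0)) * lam powr (real k / 2)"
proof -
  define e where "e k = fbar C Gh - fbar C (G k)" for k
  define g where "g k = norm (rgrad C (G k))" for k
  have H: "G k ** Q k \<in> block_orthogonal" for k
    by (rule block_orthogonal_mult[OF G Q(1)])
  have H_sym: "transpose (transpose Gh ** (G k ** Q k)) = transpose Gh ** (G k ** Q k)" for k
    by (rule procrustes(1)[OF H Gh norm_diff_aligned_le[OF Q]])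
  have H_near: "norm (G k ** Q k - Gh) \<le> sqrt n / 10" for k
    using near(1)[of k] unfolding Q(2) .
  have norm_g: "norm (rgrad C (G k ** Q k)) = g k" for k
    unfolding g_def rgrad_mult_orthogonal[OF Q(1)] norm_orthogonal_mult_right[OF Q(1)] ..
  have t0: "0 \<le> t k" for k
    using tmin(1) tmin(2)[of k] by linarith
  have descent: "ascent_const n d * (t k * (g k)\<^sup>2) \<le> e k - e (Suc k)" for k
    using sufficient_ascent[OF G t0 t_le, of k] unfolding g_def e_def iter by simp
  have PL: "e k \<le> 6 / n * (g k)\<^sup>2" for k
    using fbar_gap_le_rgrad[OF H H_sym H_near near(2), of k]
    unfolding norm_g e_def fbar_mult_orthogonal[OF Q(1)] .
  have step: "norm (G (Suc k) - G k) \<le> t k * g k" for k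
    unfolding iter g_def by (rule norm_Exp_map_rgrad_diff_le[OF G t0])
  have e0: "0 \<le> e k" for k
    using opt[OF G, of k] unfolding e_def by simp
  have g0: "0 \<le> g k" for k
    unfolding g_def by simp
  have K: "6 / n > 0" using n_ge_1 by simp
  note conv = linear_convergence_of_gradient_domination[where x = G and e = e and g = g and t = t,
      OF ascent_const_pos[OF n_ge_1 d_ge_1] K tmin(1) e0 g0 tmin(2) descent PL step lam]
  show "fbar C Gh - fbar C (G k) \<le> (fbar C Gh - fbar C (G 0)) * lam ^ k"
    using conv(1)[of k] unfolding e_def .
  obtain L where L: "G \<longlonglongrightarrow> L"
    and bound: "\<And>k. norm (G k - L) \<le> 2 * sqrt (6 / n) / ascent_const n d * sqrt (e 0) * lam powr (real k / 2)"
    using conv(3) by blast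
  \<comment> \<open>The error bound read backwards: vanishing gradients bring the iterates to the
    class of \<open>Gh\<close>, so their limit lies in it.\<close>
  have dF_le_g: "dF (G k) Gh \<le> g k / (45 / 100 * n)" for k
    using error_bound[OF H H_sym H_near near(2), of k] n_ge_1
    unfolding norm_g Q(2) by (simp add: field_simps)
  have "(\<lambda>k. norm (L - G k) + g k / (45 / 100 * n)) \<longlonglongrightarrow> norm (L - L) + 0 / (45 / 100 * n)"
    using n_ge_1 by (intro tendsto_intros L conv(2)) auto
  moreover have "dF L Gh \<le> norm (L - G k) + g k / (45 / 100 * n)" for k
    using dF_le_add_norm[of L Gh "G k"] dF_le_g[of k] by linarith
  ultimately have "dF L Gh \<le> norm (L - L) + 0 / (45 / 100 * n)"
    by (intro LIMSEQ_le_const) auto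
  then have "dF L Gh = 0"
    using dF_nonneg[of L Gh] by simp
  then have orbit: "L \<in> orbit Gh"
    by (rule mem_orbit_if_dF_zero)
  then obtain R where "orthogonal_matrix R" "L = Gh ** R"
    by (auto simp: orbit_def)
  then have "dF (G k) Gh \<le> norm (G k - L)" for k
    using dF_le by blast
  with orbit bound show "\<exists>L\<in>orbit Gh. \<forall>k. dF (G k) Gh \<le> norm (G k - L) \<and>
      norm (G k - L) \<le> 2 * sqrt (6 / n) / ascent_const n d * sqrt (fbar C Gh - fbar C (G 0)) * lam powr (real k / 2)"
    unfolding e_def by blast
qed

end

section \<open>Reduction to an aligned signal and choice of constants\<close>

lemma rho_F_le: "rho_F \<Delta> \<le> sqrt (real CARD('n)) / 10"
  for \<Delta> :: "('n::finite, 'd::finite) blockmat"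
  unfolding rho_F_def by (auto simp: min_def)

text \<open>Rotating \<open>Gs\<close> by the best \<open>Q\<close> changes neither
  \<open>Gs ** transpose Gs\<close> nor the block norms of \<open>\<Delta> ** Gs\<close>.\<close>

lemma aligned_optimum_exists:
  fixes Gs Gh :: "('n::finite, 'd::finite) blockcol" and \<Delta> C :: "('n, 'd) blockmat"
  assumes Gs: "Gs \<in> block_orthogonal" and Gh: "Gh \<in> block_orthogonal"
    and sym: "transpose \<Delta> = \<Delta>" and C: "C = Gs ** transpose Gs + \<Delta>"
    and opt: "\<forall>H\<in>block_orthogonal. fbar C H \<le> fbar C Gh"
    and opnorm_le: "opnorm \<Delta> \<le> real CARD('n) powr (3 / 4) / (20 * sqrt (real CARD('d)))"
    and noise_le: "norm_inf (\<Delta> ** Gs) \<le> real CARD('n) / 20"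
  obtains Z where "aligned_optimum Z Gh \<Delta> C"
proof -
  obtain Q where Q: "orthogonal_matrix Q"
    and Q_opt: "\<And>R. orthogonal_matrix R \<Longrightarrow> norm (Gh - Gs ** Q) \<le> norm (Gh - Gs ** R)"
    using dF_attained[of Gh Gs] by metis
  have "aligned_optimum (Gs ** Q) Gh \<Delta> C"
  proof
    show "Gs ** Q \<in> block_orthogonal"
      by (rule block_orthogonal_mult[OF Gs Q])
    show "C = Gs ** Q ** transpose (Gs ** Q) + \<Delta>"
    proof -
      have "Gs ** Q ** transpose (Gs ** Q) = Gs ** (Q ** transpose Q) ** transpose Gs"
        unfolding matrix_transpose_mul by (simp only: matrix_mul_assoc)
      then show ?thesis
        using Q C by (simp add: orthogonal_matrix_def)
    qed
    show "norm_inf (\<Delta> ** (Gs ** Q)) \<le> real CARD('n) / 20"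
      using noise_le unfolding norm_inf_le matrix_mul_assoc block_mult[of _ Q]
        norm_orthogonal_mult_right[OF Q] .
    show "norm (Gh - Gs ** Q) \<le> norm (Gh - Gs ** Q ** R)" if "orthogonal_matrix R" for R
      using Q_opt[OF orthogonal_matrix_mul[OF Q that]] by (simp only: matrix_mul_assoc)
  qed (use Gh sym opt opnorm_le in auto)
  then show thesis by (rule that)
qed

text \<open>The quantifier order records the dependence of the constants: \<open>a\<close> on the
  dimensions only, \<open>lam\<close> on these and on \<open>tmin\<close>.\<close>

theorem theorem6p2:
  shows "\<exists>a>0. \<forall>tmin>0. \<exists>lam. 0 < lam \<and> lam < 1 \<and>
    (\<forall>(Gstar :: ('n::finite, 'd::finite) blockcol) (\<Delta> :: ('n, 'd) blockmat)
        (C :: ('n, 'd) blockmat) (Ghat :: ('n, 'd) blockcol)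
        (G :: nat \<Rightarrow> ('n, 'd) blockcol) (t :: nat \<Rightarrow> real) (\<alpha> :: real)
        (Q :: nat \<Rightarrow> real ^ 'd ^ 'd).
      Gstar \<in> block_orthogonal \<longrightarrow>
      transpose \<Delta> = \<Delta> \<longrightarrow>
      C = Gstar ** transpose Gstar + \<Delta> \<longrightarrow>
      Ghat \<in> block_orthogonal \<longrightarrow>
      (\<forall>H \<in> block_orthogonal. fbar C H \<le> fbar C Ghat) \<longrightarrow>
      opnorm \<Delta> \<le> real CARD('n) powr (3 / 4) / (20 * sqrt (real CARD('d))) \<longrightarrow>
      norm_inf (\<Delta> ** Gstar) \<le> real CARD('n) / 20 \<longrightarrow>
      (\<forall>k. G k \<in> block_orthogonal) \<longrightarrow>
      (\<forall>k. G (Suc k) = Exp_map (G k) (t k *\<^sub>R rgrad C (G k))) \<longrightarrow>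
      0 < \<alpha> \<longrightarrow> \<alpha> < 1 \<longrightarrow>
      (\<forall>k. tmin \<le> t k \<and>
           t k \<le> (1 - \<alpha>) / (real CARD('n) * (real CARD('d) + 1) + opnorm \<Delta>
                    + sqrt (real CARD('d)) * norm_inf (\<Delta> ** G k))) \<longrightarrow>
      (\<forall>k. orthogonal_matrix (Q k) \<and> dF (G k) Ghat = norm (G k ** Q k - Ghat)) \<longrightarrow>
      (\<forall>k. dF (G k) Ghat \<le> rho_F \<Delta>) \<longrightarrow>
      (\<forall>k. norm_inf (G k ** Q k - Ghat) \<le> 1 / 4) \<longrightarrow>
      (\<forall>k. fbar C Ghat - fbar C (G k) \<le> (fbar C Ghat - fbar C (G 0)) * lam ^ k) \<and>
      (\<exists>Glim \<in> orbit Ghat. \<forall>k.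
         dF (G k) Ghat \<le> norm (G k - Glim) \<and>
         norm (G k - Glim)
           \<le> a * sqrt (fbar C Ghat - fbar C (G 0)) * lam powr (real k / 2)))"
proof -
  define n d where n_eq: "n = real CARD('n)" and d_eq: "d = real CARD('d)"
  define c where "c = ascent_const n d"
  have "n \<ge> 1" "d \<ge> 1"
    by (simp_all add: n_eq d_eq Suc_le_eq)
  then have c: "c > 0"
    unfolding c_def by (rule ascent_const_pos)
  \<comment> \<open>The maximum with \<open>1 / 2\<close> keeps the rate positive when
    \<open>tmin\<close> is large.\<close>
  define lam where "lam tmin = max (1 / 2) (1 - c * tmin / (6 / n))" for tmin
  have lam: "0 < lam tmin" "lam tmin < 1" "1 - c * tmin / (6 / n) \<le> lam tmin" if "tmin > 0" for tmin
  proof -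
    have "0 < c * tmin / (6 / n)"
      using c that \<open>n \<ge> 1\<close> by (intro divide_pos_pos mult_pos_pos) auto
    then show "0 < lam tmin" "lam tmin < 1" "1 - c * tmin / (6 / n) \<le> lam tmin"
      unfolding lam_def by auto
  qed
  show ?thesis
  proof (rule exI[of _ "2 * sqrt (6 / n) / c"], intro conjI allI impI, goal_cases)
    case 1
    show ?case
      using c \<open>n \<ge> 1\<close> by (intro divide_pos_pos) auto
  next
    case tmin: (2 tmin)
    show ?case
    proof (rule exI[of _ "lam tmin"], intro conjI allI impI)
      show "0 < lam tmin" "lam tmin < 1"
        using lam[OF tmin] by auto
      fix Gstar Ghat :: "('n, 'd) blockcol" and \<Delta> C :: "('n, 'd) blockmat"
        and G :: "nat \<Rightarrow> ('n, 'd) blockcol" and t :: "nat \<Rightarrow> real" and \<alpha> :: real and Q :: "nat \<Rightarrow> real ^ 'd ^ 'd"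
      assume Gstar: "Gstar \<in> block_orthogonal" and sym: "transpose \<Delta> = \<Delta>"
        and C: "C = Gstar ** transpose Gstar + \<Delta>" and Ghat: "Ghat \<in> block_orthogonal"
        and opt: "\<forall>H\<in>block_orthogonal. fbar C H \<le> fbar C Ghat"
        and opnorm_le: "opnorm \<Delta> \<le> real CARD('n) powr (3 / 4) / (20 * sqrt (real CARD('d)))"
        and noise_le: "norm_inf (\<Delta> ** Gstar) \<le> real CARD('n) / 20"
        and G: "\<forall>k. G k \<in> block_orthogonal"
        and iter: "\<forall>k. G (Suc k) = Exp_map (G k) (t k *\<^sub>R rgrad C (G k))"
        and \<alpha>: "0 < \<alpha>" "\<alpha> < 1"
        and t: "\<forall>k. tmin \<le> t k \<and> t k \<le> (1 - \<alpha>) / (real CARD('n) * (real CARD('d) + 1) + opnorm \<Delta>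
                      + sqrt (real CARD('d)) * norm_inf (\<Delta> ** G k))"
        and Q: "\<forall>k. orthogonal_matrix (Q k) \<and> dF (G k) Ghat = norm (G k ** Q k - Ghat)"
        and near: "\<forall>k. dF (G k) Ghat \<le> rho_F \<Delta>"
        and near_inf: "\<forall>k. norm_inf (G k ** Q k - Ghat) \<le> 1 / 4"
      obtain Z where "aligned_optimum Z Ghat \<Delta> C"
        by (rule aligned_optimum_exists[OF Gstar Ghat sym C opt opnorm_le noise_le])
      then interpret aligned_optimum Z Ghat \<Delta> C "real CARD('n)" "real CARD('d)" "real CARD('n) powr (1 / 4)"
        by simp_all
      have t_le: "t k \<le> 1 / (real CARD('n) * (real CARD('d) + 1) + opnorm \<Delta>
                      + sqrt (real CARD('d)) * norm_inf (\<Delta> ** G k))" for k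
      proof -
        have "0 \<le> real CARD('n) * (real CARD('d) + 1) + opnorm \<Delta> + sqrt (real CARD('d)) * norm_inf (\<Delta> ** G k)"
          using opnorm_nonneg[of \<Delta>] norm_inf_nonneg[of "\<Delta> ** G k"] by simp
        then have "(1 - \<alpha>) / (real CARD('n) * (real CARD('d) + 1) + opnorm \<Delta> + sqrt (real CARD('d)) * norm_inf (\<Delta> ** G k))
          \<le> 1 / (real CARD('n) * (real CARD('d) + 1) + opnorm \<Delta> + sqrt (real CARD('d)) * norm_inf (\<Delta> ** G k))"
          using \<alpha> by (intro divide_right_mono) auto
        with t show ?thesis by (meson order_trans)
      qed
      have near': "dF (G k) Ghat \<le> sqrt (real CARD('n)) / 10" for k
        using near rho_F_le[of \<Delta>] by (meson order_trans)
      note conv = gradient_method_converges[of G t tmin Q "lam tmin",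
          OF G[rule_format] iter[rule_format] tmin t[rule_format, THEN conjunct1] t_le
            Q[rule_format, THEN conjunct1] Q[rule_format, THEN conjunct2] near' near_inf[rule_format]
            lam(1,2)[OF tmin] lam(3)[OF tmin, unfolded c_def n_eq d_eq]]
      show "fbar C Ghat - fbar C (G k) \<le> (fbar C Ghat - fbar C (G 0)) * lam tmin ^ k" for k
        by (rule conv(1))
      show "\<exists>Glim\<in>orbit Ghat. \<forall>k. dF (G k) Ghat \<le> norm (G k - Glim) \<and> norm (G k - Glim)
          \<le> 2 * sqrt (6 / n) / c * sqrt (fbar C Ghat - fbar C (G 0)) * lam tmin powr (real k / 2)"
        using conv(2) unfolding c_def n_eq d_eq .
    qed
  qed
qed

end
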